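(* Let $E$ be a Banach space, let $S_{\mathcal A}:[0,\infty)\to\mathcal L(E)$ be strongly continuous and locally bounded with $S_{\mathcal A}(0)=I$, let $P_{\mathcal A}\in L^1((0,T);\mathcal L(E))$ for every $T>0$, and let $\mathcal N:E\to E$ be Lipschitz on bounded sets. For every $u_0\in E$ there is a unique maximal mild solution $$u\in C([0,T_{\max});E),\qquad 0<T_{\max}\le\infty,$$ with initial value $u_0$. If $T_{\max}<\infty$, then $$\limsup_{t\uparrow T_{\max}}\|u(t)\|_E=\infty .$$
   Context: $\mathcal L(E)$ is the space of bounded linear operators on $E$ with the operator norm. "Lipschitz on bounded sets" means: for every $R>0$ there is $L_R$ such that $\|\mathcal N(u)-\mathcal N(v)\|_E\le L_R\|u-v\|_E$ whenever $\|u\|_E,\|v\|_E\le R$. A mild solution with initial value $u_0$ on an interval $J=[0,T]$ or $[0,T)$ is a continuous function $u:J\to E$ satisfying $u(t)=S_{\mathcal A}(t)u_0+\int_0^tP_{\mathcal A}(t-s)\mathcal N(u(s))\,ds$ for all $t\in J$. It is maximal if it cannot be extended to a mild solution on a strictly larger interval of this type. *)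

theory Defs
  imports "HOL-Analysis.Analysis"
begin

text \<open>
  The library's Bochner integral requires a second countable range, so it covers neither an
  arbitrary Banach space \<open>E\<close> nor \<open>\<L>(E)\<close> (which is rarely separable).  The following definitions
  repeat the library's construction with Borel measurability replaced by strong measurability,
  the two agreeing up to null sets for separable metric ranges.
\<close>

definition strongly_measurable :: "'a measure \<Rightarrow> ('a \<Rightarrow> 'b::topological_space) \<Rightarrow> bool" where
  "strongly_measurable M f \<longleftrightarrow>
    (\<exists>s. (\<forall>i::nat. simple_function M (s i)) \<and> (AE x in M. (\<lambda>i. s i x) \<longlonglongrightarrow> f x))"

definition has_strong_bochner_integral ::
    "'a measure \<Rightarrow> ('a \<Rightarrow> 'b::real_normed_vector) \<Rightarrow> 'b \<Rightarrow> bool" where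
  "has_strong_bochner_integral M f I \<longleftrightarrow>
    strongly_measurable M f \<and>
    (\<exists>s. (\<forall>i::nat. Bochner_Integration.simple_bochner_integrable M (s i)) \<and>
         (\<lambda>i. \<integral>\<^sup>+x. ennreal (norm (f x - s i x)) \<partial>M) \<longlonglongrightarrow> 0 \<and>
         (\<lambda>i. Bochner_Integration.simple_bochner_integral M (s i)) \<longlonglongrightarrow> I)"

definition strong_bochner_integrable :: "'a measure \<Rightarrow> ('a \<Rightarrow> 'b::real_normed_vector) \<Rightarrow> bool" where
  "strong_bochner_integrable M f \<longleftrightarrow> (\<exists>I. has_strong_bochner_integral M f I)"

definition strong_bochner_integral :: "'a measure \<Rightarrow> ('a \<Rightarrow> 'b::real_normed_vector) \<Rightarrow> 'b" where
  "strong_bochner_integral M f = (THE I. has_strong_bochner_integral M f I)"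

definition bochner_L1 :: "'a measure \<Rightarrow> ('a \<Rightarrow> 'b::real_normed_vector) \<Rightarrow> bool" where
  "bochner_L1 M f \<longleftrightarrow> strongly_measurable M f \<and> (\<integral>\<^sup>+x. ennreal (norm (f x)) \<partial>M) < \<infinity>"

definition lipschitz_on_bounded_sets :: "('a::real_normed_vector \<Rightarrow> 'a) \<Rightarrow> bool" where
  "lipschitz_on_bounded_sets N \<longleftrightarrow>
    (\<forall>R>0. \<exists>L. \<forall>u v. norm u \<le> R \<and> norm v \<le> R \<longrightarrow> norm (N u - N v) \<le> L * norm (u - v))"

text \<open>\<open>[0,T)\<close> for \<open>T \<in> (0,\<infinity>]\<close>\<close>

definition half_open_interval :: "ereal \<Rightarrow> real set" where
  "half_open_interval T = {t. 0 \<le> t \<and> ereal t < T}"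

definition time_interval :: "real set \<Rightarrow> bool" where
  "time_interval J \<longleftrightarrow>
    (\<exists>T::real. 0 < T \<and> J = {0..T}) \<or> (\<exists>T::ereal. 0 < T \<and> J = half_open_interval T)"

text \<open>
  Functions on a time interval \<open>J\<close> are represented by total functions; only their values on \<open>J\<close>
  matter.  Likewise only \<open>S t\<close> for \<open>t \<ge> 0\<close> and the a.e. class of \<open>P\<close> on \<open>(0,\<infinity>)\<close> matter.
\<close>

definition mild_solution ::
    "(real \<Rightarrow> 'a::real_normed_vector \<Rightarrow>\<^sub>L 'a) \<Rightarrow> (real \<Rightarrow> 'a \<Rightarrow>\<^sub>L 'a) \<Rightarrow> ('a \<Rightarrow> 'a) \<Rightarrow> 'a
      \<Rightarrow> real set \<Rightarrow> (real \<Rightarrow> 'a) \<Rightarrow> bool" where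
  "mild_solution S P N u0 J u \<longleftrightarrow>
    time_interval J \<and> continuous_on J u \<and>
    (\<forall>t\<in>J. strong_bochner_integrable (lebesgue_on {0..t}) (\<lambda>s. blinfun_apply (P (t - s)) (N (u s))) \<and>
      u t = blinfun_apply (S t) u0 +
        strong_bochner_integral (lebesgue_on {0..t}) (\<lambda>s. blinfun_apply (P (t - s)) (N (u s))))"

definition maximal_mild_solution ::
    "(real \<Rightarrow> 'a::real_normed_vector \<Rightarrow>\<^sub>L 'a) \<Rightarrow> (real \<Rightarrow> 'a \<Rightarrow>\<^sub>L 'a) \<Rightarrow> ('a \<Rightarrow> 'a) \<Rightarrow> 'a
      \<Rightarrow> real set \<Rightarrow> (real \<Rightarrow> 'a) \<Rightarrow> bool" where
  "maximal_mild_solution S P N u0 J u \<longleftrightarrow>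
    mild_solution S P N u0 J u \<and>
    \<not> (\<exists>J' v. J \<subset> J' \<and> mild_solution S P N u0 J' v \<and> (\<forall>t\<in>J. v t = u t))"

end

theory Submission
  imports Defs
begin

text \<open>
  Approximation in \<open>L\<^sup>1\<close> by simple functions shows that the strong Bochner integral over an interval
  coincides with the Henstock--Kurzweil integral, whose calculus is available for arbitrary Banach
  spaces.  With \<open>G h = \<integral>\<^sub>0\<^sup>h \<parallel>P\<parallel>\<close>, which tends to \<open>0\<close> with \<open>h\<close>, two continuous functions bounded by
  \<open>R\<close> that agree on \<open>[0,a]\<close> have convolution terms differing at time \<open>t\<close> by at most \<open>L\<^sub>R G (t - a)\<close>
  times their sup distance.  This gives uniqueness by steps of fixed length and, through Banach's
  fixed point theorem, an extension of every solution on \<open>[0,t\<^sub>0]\<close> bounded by \<open>R\<close> to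
  \<open>[0,t\<^sub>0 + d]\<close> with \<open>d\<close> depending only on \<open>R\<close> and an upper bound for \<open>t\<^sub>0\<close>.  A solution bounded near
  a finite \<open>T\<^sub>m\<^sub>a\<^sub>x\<close> could therefore be continued past it.
\<close>

section \<open>Strong Bochner and Henstock--Kurzweil integrals\<close>

lemma complete_measure_lebesgue_on:
  assumes "A \<in> sets lebesgue"
  shows "complete_measure (lebesgue_on A)"
proof
  fix B C assume "B \<subseteq> C" "C \<in> null_sets (lebesgue_on A)"
  then have "C \<subseteq> A" "C \<in> null_sets lebesgue"
    using assms by (auto simp: null_sets_restrict_space)
  then have "B \<in> null_sets lebesgue" "B \<subseteq> A"
    using \<open>B \<subseteq> C\<close> by (auto simp: completion.complete2)
  then have "B \<in> null_sets (lebesgue_on A)"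
    using assms by (auto simp: null_sets_restrict_space)
  then show "B \<in> sets (lebesgue_on A)" by auto
qed

text \<open>The pointwise \<open>lim\<close> of the \<open>g i\<close> is measurable, and preimages
  under \<open>f\<close> differ from preimages under it only inside a null set, every subset of
  which is measurable by completeness. This suits \<open>strongly_measurable\<close>, which says
  nothing about \<open>f\<close> on the exceptional null set.\<close>

lemma (in complete_measure) borel_measurable_AE_LIMSEQ:
  fixes f :: "'a \<Rightarrow> real"
  assumes [measurable]: "\<And>i. g i \<in> borel_measurable M"
    and lim: "AE x in M. (\<lambda>i. g i x) \<longlonglongrightarrow> f x"
  shows "f \<in> borel_measurable M"
proof (rule borel_measurableI)
  fix U :: "real set" assume "open U"
  have "(\<lambda>x. lim (\<lambda>i. g i x)) \<in> borel_measurable M" by measurable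
  then have *: "(\<lambda>x. lim (\<lambda>i. g i x)) -` U \<inter> space M \<in> sets M"
    using \<open>open U\<close> by (auto intro: measurable_sets)
  show "f -` U \<inter> space M \<in> sets M"
    by (rule in_sets_AE[OF _ *]) (use lim in \<open>auto elim!: eventually_mono simp: limI\<close>)
qed

text \<open>The errors \<open>norm (f x - s i x)\<close> of simple approximations are real functions
  of this shape; their measurability gives access to the ordinary theory of real integrals.\<close>

lemma (in complete_measure) strongly_measurable_norm_diff:
  fixes f :: "'a \<Rightarrow> 'b::real_normed_vector"
  assumes "strongly_measurable M f" and "simple_function M h"
  shows "(\<lambda>x. norm (f x - h x)) \<in> borel_measurable M"
proof -
  obtain s where s: "\<And>i::nat. simple_function M (s i)" "AE x in M. (\<lambda>i. s i x) \<longlonglongrightarrow> f x"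
    using assms unfolding strongly_measurable_def by auto
  show ?thesis
  proof (rule borel_measurable_AE_LIMSEQ)
    show "(\<lambda>x. norm (s i x - h x)) \<in> borel_measurable M" for i
      by (intro borel_measurable_simple_function simple_function_compose2[where h="\<lambda>x y. norm (x - y)"] s assms)
    show "AE x in M. (\<lambda>i. norm (s i x - h x)) \<longlonglongrightarrow> norm (f x - h x)"
      using s(2) by eventually_elim (intro tendsto_intros)
  qed
qed

lemma (in complete_measure) strongly_measurable_norm:
  fixes f :: "'a \<Rightarrow> 'b::real_normed_vector"
  assumes "strongly_measurable M f"
  shows "(\<lambda>x. norm (f x)) \<in> borel_measurable M"
  using strongly_measurable_norm_diff[OF assms, of "\<lambda>_. 0"] by simp

section \<open>From Bochner to Henstock--Kurzweil integrals\<close>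

lemma simple_function_has_integral:
  fixes s :: "real \<Rightarrow> 'b::banach"
  assumes "simple_function (lebesgue_on {a..b}) s"
  shows "(s has_integral Bochner_Integration.simple_bochner_integral (lebesgue_on {a..b}) s) {a..b}"
proof -
  \<comment> \<open>The level sets of \<open>s\<close> are bounded and Lebesgue measurable, so each
    indicator has its measure as integral; \<open>s\<close> is the finite sum of its values times
    these indicators.\<close>
  define A where "A y = s -` {y} \<inter> {a..b}" for y
  have fin: "finite (s ` {a..b})"
    using assms by (auto simp: simple_function_def)
  have A: "A y \<in> sets lebesgue" if "y \<in> s ` {a..b}" for y
    using assms that by (auto simp: simple_function_def A_def sets_restrict_space_iff)
  have meas: "(indicat_real (A y) has_integral measure lebesgue (A y)) {a..b}" if "y \<in> s ` {a..b}" for y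
  proof -
    have "A y \<in> lmeasurable"
      by (rule bounded_set_imp_lmeasurable) (use A[OF that] bounded_subset[of "{a..b}" "A y"] in \<open>auto simp: A_def\<close>)
    then have "(indicat_real (A y) has_integral measure lebesgue (A y)) UNIV"
      by (simp add: lmeasurable_iff_has_integral)
    moreover have "indicat_real (A y) = (\<lambda>x. if x \<in> {a..b} then indicat_real (A y) x else 0)"
      by (auto simp: A_def indicator_def)
    ultimately show ?thesis
      by (metis has_integral_restrict_UNIV)
  qed
  have "((\<lambda>x. \<Sum>y\<in>s ` {a..b}. indicat_real (A y) x *\<^sub>R y) has_integral
     (\<Sum>y\<in>s ` {a..b}. measure lebesgue (A y) *\<^sub>R y)) {a..b}"
    by (intro has_integral_sum fin has_integral_scaleR_left meas)
  moreover have "(\<Sum>y\<in>s ` {a..b}. measure lebesgue (A y) *\<^sub>R y)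
     = Bochner_Integration.simple_bochner_integral (lebesgue_on {a..b}) s"
    unfolding Bochner_Integration.simple_bochner_integral_def
  proof (rule sum.cong)
    fix y assume "y \<in> s ` space (lebesgue_on {a..b})"
    have "{x \<in> space (lebesgue_on {a..b}). s x = y} = A y" by (auto simp: A_def)
    then show "measure lebesgue (A y) *\<^sub>R y = measure (lebesgue_on {a..b}) {x \<in> space (lebesgue_on {a..b}). s x = y} *\<^sub>R y"
      by (simp add: measure_restrict_space A_def)
  qed simp
  moreover have "(\<Sum>y\<in>s ` {a..b}. indicat_real (A y) x *\<^sub>R y) = s x" if "x \<in> {a..b}" for x
  proof -
    have "(\<Sum>y\<in>s ` {a..b}. indicat_real (A y) x *\<^sub>R y) = (\<Sum>y\<in>s ` {a..b}. if y = s x then s x else 0)"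
      by (rule sum.cong) (use that in \<open>auto simp: A_def indicator_def\<close>)
    then show ?thesis using fin that by simp
  qed
  ultimately show ?thesis
    by (metis (no_types, lifting) has_integral_cong)
qed

text \<open>Riemann sums of \<open>f\<close> and \<open>g\<close> over the same division differ in
  norm by at most the Riemann sum of \<open>norm (f x - g x)\<close>. Hence all fine Riemann sums of
  \<open>f\<close> cluster near the integral of \<open>g\<close>, and the Cauchy criterion
  applies.\<close>

lemma integrable_on_L1_limit:
  fixes f :: "real \<Rightarrow> 'b::banach"
  assumes "\<And>e. e > 0 \<Longrightarrow> \<exists>g. g integrable_on {a..b} \<and> (\<lambda>x. norm (f x - g x)) integrable_on {a..b} \<and>
     integral {a..b} (\<lambda>x. norm (f x - g x)) < e"
  shows "f integrable_on {a..b}"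
  unfolding cbox_interval[symmetric] integrable_Cauchy
proof (intro allI impI)
  fix e :: real assume "e > 0"
  define h where "h g x = norm (f x - g x)" for g x
  \<comment> \<open>The three shares of e/6 are the L1 distance, the gauge error for
    \<open>h g\<close> and the gauge error for \<open>g\<close>. Their total e/2 separates a fine
    sum of \<open>f\<close> from \<open>G\<close>, so two such sums are within e of each
    other.\<close>
  obtain g where g: "g integrable_on {a..b}" "h g integrable_on {a..b}" "integral {a..b} (h g) < e/6"
    using assms[of "e/6"] \<open>e > 0\<close> unfolding h_def by auto
  define H where "H = integral {a..b} (h g)"
  define G where "G = integral {a..b} g"
  have "(h g has_integral H) (cbox a b)" "(g has_integral G) (cbox a b)"
    using g by (auto simp: H_def G_def integrable_integral)
  then obtain c d where c: "gauge c" "\<And>p. p tagged_division_of cbox a b \<Longrightarrow> c fine p \<Longrightarrow>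
       norm ((\<Sum>(x,K)\<in>p. measure lborel K *\<^sub>R h g x) - H) < e/6"
    and d: "gauge d" "\<And>p. p tagged_division_of cbox a b \<Longrightarrow> d fine p \<Longrightarrow>
       norm ((\<Sum>(x,K)\<in>p. measure lborel K *\<^sub>R g x) - G) < e/6"
    using \<open>e > 0\<close> unfolding has_integral by (metis divide_pos_pos zero_less_numeral)
  have *: "norm ((\<Sum>(x,K)\<in>p. measure lborel K *\<^sub>R f x) - G) < e/2"
    if p: "p tagged_division_of cbox a b" "(\<lambda>x. c x \<inter> d x) fine p" for p
  proof -
    have cp: "c fine p" and dp: "d fine p" using p by (auto simp: fine_Int)
    have "norm ((\<Sum>(x,K)\<in>p. measure lborel K *\<^sub>R f x) - (\<Sum>(x,K)\<in>p. measure lborel K *\<^sub>R g x))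
       = norm (\<Sum>(x,K)\<in>p. measure lborel K *\<^sub>R (f x - g x))"
      by (simp add: sum_subtractf[symmetric] case_prod_unfold scaleR_diff_right)
    also have "\<dots> \<le> (\<Sum>(x,K)\<in>p. measure lborel K *\<^sub>R h g x)"
      unfolding h_def by (rule sum_norm_le) auto
    also have "\<dots> < e/3"
      using c(2)[OF p(1) cp] g(3) unfolding H_def real_norm_def by linarith
    finally have "norm ((\<Sum>(x,K)\<in>p. measure lborel K *\<^sub>R f x) - (\<Sum>(x,K)\<in>p. measure lborel K *\<^sub>R g x)) < e/3" .
    with d(2)[OF p(1) dp] show ?thesis
      using norm_triangle_ineq[of "(\<Sum>(x,K)\<in>p. measure lborel K *\<^sub>R f x) - (\<Sum>(x,K)\<in>p. measure lborel K *\<^sub>R g x)"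
          "(\<Sum>(x,K)\<in>p. measure lborel K *\<^sub>R g x) - G"] by simp
  qed
  show "\<exists>\<gamma>. gauge \<gamma> \<and> (\<forall>p q. p tagged_division_of cbox a b \<and> \<gamma> fine p \<and>
      q tagged_division_of cbox a b \<and> \<gamma> fine q \<longrightarrow>
      norm ((\<Sum>(x,K)\<in>p. measure lborel K *\<^sub>R f x) - (\<Sum>(x,K)\<in>q. measure lborel K *\<^sub>R f x)) < e)"
  proof (intro exI conjI allI impI; (elim conjE)?)
    show "gauge (\<lambda>x. c x \<inter> d x)" using c d by auto
    fix p q assume "p tagged_division_of cbox a b" "(\<lambda>x. c x \<inter> d x) fine p"
      "q tagged_division_of cbox a b" "(\<lambda>x. c x \<inter> d x) fine q"
    then show "norm ((\<Sum>(x,K)\<in>p. measure lborel K *\<^sub>R f x) - (\<Sum>(x,K)\<in>q. measure lborel K *\<^sub>R f x)) < e"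
      using *[of p] *[of q] by (meson norm_triangle_half_l)
  qed
qed

text \<open>Converts the extended nonnegative error integrals of the strong Bochner theory into real
  Henstock--Kurzweil integrals, for which the norm estimates are available.\<close>

lemma nonneg_has_integral_lebesgue_on:
  fixes h :: "real \<Rightarrow> real"
  assumes "h \<in> borel_measurable (lebesgue_on A)" "A \<in> sets lebesgue" "\<And>x. 0 \<le> h x"
    and "(\<integral>\<^sup>+x. ennreal (h x) \<partial>lebesgue_on A) < \<infinity>"
  shows "h integrable_on A" "(\<integral>\<^sup>+x. ennreal (h x) \<partial>lebesgue_on A) = ennreal (integral A h)"
proof -
  have int: "integrable (lebesgue_on A) h"
    using assms by (intro integrableI_bounded) auto
  show "h integrable_on A" using int assms(2) by (rule integrable_on_lebesgue_on)
  show "(\<integral>\<^sup>+x. ennreal (h x) \<partial>lebesgue_on A) = ennreal (integral A h)"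
    using int assms by (simp add: nn_integral_eq_integral lebesgue_integral_eq_integral)
qed

text \<open>L1 approximation by the \<open>s i\<close> makes \<open>f\<close> integrable, and the
  integral of \<open>f - s i\<close> is dominated by that of its norm. The simple integrals
  therefore tend to \<open>integral {a..b} f\<close> as well as to \<open>I\<close>.\<close>

lemma has_strong_bochner_integral_imp_has_integral:
  fixes f :: "real \<Rightarrow> 'b::banach"
  assumes "has_strong_bochner_integral (lebesgue_on {a..b}) f I"
  shows "(f has_integral I) {a..b}"
proof -
  define M where "M = lebesgue_on {a..b}"
  interpret complete_measure M unfolding M_def by (rule complete_measure_lebesgue_on) simp
  obtain s where f: "strongly_measurable M f"
    and s: "\<And>i::nat. Bochner_Integration.simple_bochner_integrable M (s i)"
      "(\<lambda>i. \<integral>\<^sup>+x. ennreal (norm (f x - s i x)) \<partial>M) \<longlonglongrightarrow> 0"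
      "(\<lambda>i. Bochner_Integration.simple_bochner_integral M (s i)) \<longlonglongrightarrow> I"
    using assms unfolding has_strong_bochner_integral_def M_def by auto
  have sf: "simple_function M (s i)" for i
    using s(1)[of i] by (auto elim: Bochner_Integration.simple_bochner_integrable.cases)
  have si: "(s i has_integral Bochner_Integration.simple_bochner_integral M (s i)) {a..b}" for i
    using simple_function_has_integral sf unfolding M_def by blast
  define h where "h i x = norm (f x - s i x)" for i x
  have hm: "h i \<in> borel_measurable (lebesgue_on {a..b})" for i
    unfolding h_def M_def[symmetric] by (rule strongly_measurable_norm_diff[OF f sf])
  \<comment> \<open>An individual error integral may be infinite; convergence to 0 makes it finite
    from some index on, so integrability of \<open>h i\<close> is claimed only eventually.\<close>
  have ev: "\<forall>\<^sub>F i in sequentially. h i integrable_on {a..b} \<and> integral {a..b} (h i) < e" if "e > 0" for e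
  proof -
    have "\<forall>\<^sub>F i in sequentially. (\<integral>\<^sup>+x. ennreal (h i x) \<partial>M) < ennreal e"
      using order_tendstoD(2)[OF s(2), of "ennreal e"] that by (simp add: h_def)
    then show ?thesis
    proof eventually_elim
      case (elim i)
      have *: "h i integrable_on {a..b}" "(\<integral>\<^sup>+x. ennreal (h i x) \<partial>lebesgue_on {a..b}) = ennreal (integral {a..b} (h i))"
        by (rule nonneg_has_integral_lebesgue_on[OF hm];
            use elim in \<open>auto simp: h_def M_def intro: less_trans[OF _ ennreal_less_top]\<close>)+
      with elim that show ?case by (simp add: M_def ennreal_less_iff integral_nonneg h_def)
    qed
  qed
  have int: "f integrable_on {a..b}"
  proof (rule integrable_on_L1_limit)
    fix e :: real assume "e > 0"
    from eventually_happens'[OF _ ev[OF this]] obtain i where "h i integrable_on {a..b}" "integral {a..b} (h i) < e"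
      by auto
    then show "\<exists>g. g integrable_on {a..b} \<and> (\<lambda>x. norm (f x - g x)) integrable_on {a..b} \<and>
        integral {a..b} (\<lambda>x. norm (f x - g x)) < e"
      using si[of i] unfolding h_def by blast
  qed
  have "(\<lambda>i. Bochner_Integration.simple_bochner_integral M (s i)) \<longlonglongrightarrow> integral {a..b} f"
  proof (rule LIMSEQ_I)
    fix e :: real assume "e > 0"
    have "\<forall>\<^sub>F i in sequentially. norm (Bochner_Integration.simple_bochner_integral M (s i) - integral {a..b} f) < e"
      using ev[OF \<open>e > 0\<close>]
    proof eventually_elim
      case (elim i)
      have "norm (Bochner_Integration.simple_bochner_integral M (s i) - integral {a..b} f)
         = norm (integral {a..b} (\<lambda>x. f x - s i x))"
        using si[of i] int by (subst integral_diff) (auto simp: norm_minus_commute integral_unique)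
      also have "\<dots> \<le> integral {a..b} (h i)"
        by (rule integral_norm_bound_integral) (use elim si[of i] int in \<open>auto simp: h_def intro!: integrable_diff\<close>)
      finally show ?case using elim by simp
    qed
    then show "\<exists>k. \<forall>i\<ge>k. norm (Bochner_Integration.simple_bochner_integral M (s i) - integral {a..b} f) < e"
      by (simp add: eventually_sequentially)
  qed
  with s(3) have "I = integral {a..b} f" by (rule LIMSEQ_unique)
  with int show ?thesis by (simp add: has_integral_integral)
qed

text \<open>Every candidate value is a Henstock--Kurzweil integral and those are unique, which
  settles the definite description in \<open>strong_bochner_integral\<close>.\<close>

corollary strong_bochner_integral_eq_integral:
  fixes f :: "real \<Rightarrow> 'b::banach"
  assumes "strong_bochner_integrable (lebesgue_on {a..b}) f"
  shows "f integrable_on {a..b}" "strong_bochner_integral (lebesgue_on {a..b}) f = integral {a..b} f"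
proof -
  obtain I where I: "has_strong_bochner_integral (lebesgue_on {a..b}) f I"
    using assms unfolding strong_bochner_integrable_def by auto
  note * = has_strong_bochner_integral_imp_has_integral
  show "f integrable_on {a..b}" using *[OF I] by auto
  show "strong_bochner_integral (lebesgue_on {a..b}) f = integral {a..b} f"
    unfolding strong_bochner_integral_def
    using I * by (metis (no_types, lifting) integral_unique the_equality)
qed

text \<open>Dominated convergence gives L1 convergence of truncated simple functions. Their
  integrals form a Cauchy sequence, because the difference of two is bounded by the sum of the two
  errors, and completeness of the range supplies the value.\<close>

lemma bochner_L1_imp_strong_bochner_integrable:
  fixes f :: "real \<Rightarrow> 'b::banach"
  assumes "bochner_L1 (lebesgue_on {a..b}) f"
  shows "strong_bochner_integrable (lebesgue_on {a..b}) f"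
proof -
  define M where "M = lebesgue_on {a..b}"
  interpret complete_measure M unfolding M_def by (rule complete_measure_lebesgue_on) simp
  interpret finite_measure M
    using emeasure_lborel_cbox_finite[of a b] by (intro finite_measureI) (simp add: M_def emeasure_restrict_space less_top[symmetric])
  obtain s where f: "strongly_measurable M f"
    and s: "\<And>i::nat. simple_function M (s i)" "AE x in M. (\<lambda>i. s i x) \<longlonglongrightarrow> f x"
    and fin: "(\<integral>\<^sup>+x. ennreal (norm (f x)) \<partial>M) < \<infinity>"
    using assms unfolding bochner_L1_def strongly_measurable_def M_def by auto
  \<comment> \<open>truncation makes the approximating sequence dominated by \<open>2 * norm (f x)\<close>\<close>
  define r where "r i x = (if norm (s i x) \<le> 2 * norm (f x) then s i x else 0)" for i x
  have nf[measurable]: "(\<lambda>x. norm (f x)) \<in> borel_measurable M"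
    by (rule strongly_measurable_norm[OF f])
  have [measurable]: "(\<lambda>x. norm (s i x)) \<in> borel_measurable M" for i
    by (intro borel_measurable_simple_function simple_function_compose1[OF s(1)])
  have r: "simple_function M (r i)" for i
    unfolding r_def[abs_def] by (intro simple_function_If s) auto
  have rb: "Bochner_Integration.simple_bochner_integrable M (r i)" for i
    by (rule Bochner_Integration.simple_bochner_integrable.intros[OF r]) simp
  have rlim: "AE x in M. (\<lambda>i. r i x) \<longlonglongrightarrow> f x"
    using s(2)
  proof eventually_elim
    case (elim x)
    \<comment> \<open>Where \<open>f x\<close> vanishes, truncation forces \<open>r i x\<close> to
      be 0 for all i. Elsewhere the norm of \<open>s i x\<close> eventually drops below twice the
      norm of \<open>f x\<close>, and truncation no longer acts.\<close>
    show ?case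
    proof (cases "f x = 0")
      case True
      then show ?thesis by (simp add: r_def cong: if_cong)
    next
      case False
      have "\<forall>\<^sub>F i in sequentially. norm (s i x) < 2 * norm (f x)"
        using False by (intro order_tendstoD(2)[OF tendsto_norm[OF elim]]) auto
      then have "\<forall>\<^sub>F i in sequentially. s i x = r i x"
        by eventually_elim (auto simp: r_def)
      with elim show ?thesis by (rule Lim_transform_eventually)
    qed
  qed
  have lim: "(\<lambda>i. \<integral>\<^sup>+x. ennreal (norm (f x - r i x)) \<partial>M) \<longlonglongrightarrow> (\<integral>\<^sup>+x. ennreal 0 \<partial>M)"
  proof (rule nn_integral_dominated_convergence[where w="\<lambda>x. ennreal (3 * norm (f x))"])
    show "(\<lambda>x. ennreal (norm (f x - r i x))) \<in> borel_measurable M" for i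
      using strongly_measurable_norm_diff[OF f r] by measurable
    show "AE x in M. ennreal (norm (f x - r i x)) \<le> ennreal (3 * norm (f x))" for i
    proof (intro AE_I2 ennreal_leI)
      fix x show "norm (f x - r i x) \<le> 3 * norm (f x)"
        using norm_triangle_ineq4[of "f x" "r i x"] norm_ge_zero[of "f x"] unfolding r_def by (auto split: if_splits simp del: norm_ge_zero)
    qed
    show "(\<integral>\<^sup>+x. ennreal (3 * norm (f x)) \<partial>M) < \<infinity>"
      using fin by (simp add: ennreal_mult nn_integral_cmult ennreal_mult_less_top)
    show "AE x in M. (\<lambda>i. ennreal (norm (f x - r i x))) \<longlonglongrightarrow> ennreal 0"
      using rlim
    proof eventually_elim
      case (elim x)
      then have "(\<lambda>i. norm (f x - r i x)) \<longlonglongrightarrow> norm (f x - f x)" by (intro tendsto_intros)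
      then show ?case by (intro tendsto_ennrealI) simp
    qed
  qed auto
  define I :: "(real \<Rightarrow> 'b) \<Rightarrow> 'b" where "I = Bochner_Integration.simple_bochner_integral M"
  have ri: "(r i has_integral I (r i)) {a..b}" for i
    unfolding I_def M_def by (rule simple_function_has_integral[OF r[unfolded M_def]])
  have "Cauchy (\<lambda>i. I (r i))"
  proof (rule metric_CauchyI)
    fix e :: real assume "e > 0"
    have "\<forall>\<^sub>F i in sequentially. (\<integral>\<^sup>+x. ennreal (norm (f x - r i x)) \<partial>M) < ennreal (e/2)"
      using order_tendstoD(2)[OF lim, of "ennreal (e/2)"] \<open>e > 0\<close> by simp
    then obtain k where k: "\<And>i. i \<ge> k \<Longrightarrow> (\<integral>\<^sup>+x. ennreal (norm (f x - r i x)) \<partial>M) < ennreal (e/2)"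
      by (auto simp: eventually_sequentially)
    have "dist (I (r i)) (I (r j)) < e" if "i \<ge> k" "j \<ge> k" for i j
    proof -
      have h: "(\<lambda>x. norm (f x - r i x)) integrable_on {a..b}" "integral {a..b} (\<lambda>x. norm (f x - r i x)) < e/2"
        if "i \<ge> k" for i
      proof -
        have *: "(\<lambda>x. norm (f x - r i x)) integrable_on {a..b}"
          "(\<integral>\<^sup>+x. ennreal (norm (f x - r i x)) \<partial>lebesgue_on {a..b}) = ennreal (integral {a..b} (\<lambda>x. norm (f x - r i x)))"
          by (rule nonneg_has_integral_lebesgue_on[OF strongly_measurable_norm_diff[OF f r, unfolded M_def]];
              use k[OF that] in \<open>auto simp: M_def intro: less_trans[OF _ ennreal_less_top]\<close>)+
        show "(\<lambda>x. norm (f x - r i x)) integrable_on {a..b}" by fact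
        show "integral {a..b} (\<lambda>x. norm (f x - r i x)) < e/2"
          using k[OF that] *(2) \<open>e > 0\<close> * by (simp add: M_def ennreal_less_iff integral_nonneg)
      qed
      have "dist (I (r i)) (I (r j)) = norm (integral {a..b} (\<lambda>x. r i x - r j x))"
        using ri[of i] ri[of j] by (subst integral_diff) (auto simp: dist_norm integral_unique)
      also have "\<dots> \<le> integral {a..b} (\<lambda>x. norm (f x - r i x) + norm (f x - r j x))"
      proof (rule integral_norm_bound_integral)
        fix x show "norm (r i x - r j x) \<le> norm (f x - r i x) + norm (f x - r j x)"
          using norm_triangle_ineq4[of "f x - r j x" "f x - r i x"] by simp
      qed (use h that ri[of i] ri[of j] in \<open>auto intro!: integrable_diff integrable_add\<close>)
      also have "\<dots> < e"
        using h[OF that(1)] h[OF that(2)] by (subst integral_add) simp_all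
      finally show ?thesis .
    qed
    then show "\<exists>k. \<forall>i\<ge>k. \<forall>j\<ge>k. dist (I (r i)) (I (r j)) < e" by blast
  qed
  then obtain l where "(\<lambda>i. I (r i)) \<longlonglongrightarrow> l"
    using Cauchy_convergent convergent_def by blast
  with f rb lim show ?thesis
    unfolding strong_bochner_integrable_def has_strong_bochner_integral_def M_def[symmetric] I_def
    by auto
qed

section \<open>Strong measurability of the convolution integrand\<close>

lemma simple_function_compose_measurable:
  assumes "f \<in> measurable M N" "simple_function N g"
  shows "simple_function M (\<lambda>x. g (f x))"
  unfolding simple_function_def
proof safe
  have "(\<lambda>x. g (f x)) ` space M \<subseteq> g ` space N"
    using measurable_space[OF assms(1)] by auto
  then show "finite ((\<lambda>x. g (f x)) ` space M)"
    using assms(2) by (auto simp: simple_function_def intro: finite_subset)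
  fix x assume x: "x \<in> space M"
  have "(\<lambda>x. g (f x)) -` {g (f x)} \<inter> space M = f -` (g -` {g (f x)} \<inter> space N) \<inter> space M"
    using measurable_space[OF assms(1)] by auto
  moreover have "g -` {g (f x)} \<inter> space N \<in> sets N"
    using assms(2) measurable_space[OF assms(1) x] by (auto simp: simple_function_def)
  ultimately show "(\<lambda>x. g (f x)) -` {g (f x)} \<inter> space M \<in> sets M"
    using measurable_sets[OF assms(1)] by metis
qed

lemma lebesgue_measurable_reflect: "(\<lambda>s. t - s) \<in> measurable lebesgue (lebesgue :: real measure)"
  using lebesgue_affine_measurable[where c="\<lambda>_::real. -1" and t=t] by simp

text \<open>The affine map with slope -1 has Jacobian 1 in absolute value, so it preserves Lebesgue
  measure and in particular null sets.\<close>

lemma AE_lebesgue_reflect: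
  fixes Q :: "real \<Rightarrow> bool"
  assumes "AE x in lebesgue. Q x"
  shows "AE x in lebesgue. Q (t - x)"
proof -
  have "lebesgue = density (distr lebesgue lebesgue (\<lambda>x. t + (-1) * x)) (\<lambda>_. ennreal \<bar>-1::real\<bar>)"
    by (rule lebesgue_real_affine) simp
  also have "\<dots> = distr lebesgue lebesgue (\<lambda>x. t - x)"
    by (simp add: density_1)
  finally have "AE x in distr lebesgue lebesgue (\<lambda>x. t - x). Q x"
    using assms by metis
  then show ?thesis
    by (rule AE_distrD[OF lebesgue_measurable_reflect])
qed

text \<open>On a bounded interval the floor takes finitely many values. With
  \<open>floor_approx\<close>, evaluating a continuous function at the grid points floor(n x)/n
  yields simple functions converging pointwise to it.\<close>

lemma simple_function_floor:
  "simple_function (lebesgue_on {a..b}) (\<lambda>x. \<lfloor>real n * x\<rfloor>)"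
  unfolding simple_function_def
proof safe
  have "(\<lambda>x. \<lfloor>real n * x\<rfloor>) ` space (lebesgue_on {a..b}) \<subseteq> {\<lfloor>real n * a\<rfloor>..\<lfloor>real n * b\<rfloor>}"
    by (auto intro!: floor_mono mult_left_mono)
  then show "finite ((\<lambda>x. \<lfloor>real n * x\<rfloor>) ` space (lebesgue_on {a..b}))"
    using finite_subset by blast
  fix x
  have "(\<lambda>x. \<lfloor>real n * x\<rfloor>) \<in> measurable (borel::real measure) (count_space UNIV)"
    by measurable
  then have "(\<lambda>x. \<lfloor>real n * x\<rfloor>) \<in> measurable (lebesgue_on {a..b}) (count_space UNIV)"
    by (intro measurable_restrict_space1 measurable_completion) simp
  from measurable_sets[OF this, of "{\<lfloor>real n * x\<rfloor>}"]
  show "(\<lambda>x. \<lfloor>real n * x\<rfloor>) -` {\<lfloor>real n * x\<rfloor>} \<inter> space (lebesgue_on {a..b}) \<in> sets (lebesgue_on {a..b})"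
    by auto
qed

lemma floor_approx: "(\<lambda>i. real_of_int \<lfloor>real i * x\<rfloor> / real i) \<longlonglongrightarrow> x"
proof (rule tendsto_sandwich)
  show "\<forall>\<^sub>F i in sequentially. x - 1 / real i \<le> real_of_int \<lfloor>real i * x\<rfloor> / real i"
    using eventually_gt_at_top[of 0]
  proof eventually_elim
    case (elim i)
    have "real i * x - 1 \<le> real_of_int \<lfloor>real i * x\<rfloor>" by linarith
    then have "(real i * x - 1) / real i \<le> real_of_int \<lfloor>real i * x\<rfloor> / real i"
      by (rule divide_right_mono) simp
    with elim show ?case by (simp add: diff_divide_distrib)
  qed
  show "\<forall>\<^sub>F i in sequentially. real_of_int \<lfloor>real i * x\<rfloor> / real i \<le> x"
    using eventually_gt_at_top[of 0]
    by eventually_elim (simp add: field_simps)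
  show "(\<lambda>i. x - 1 / real i) \<longlonglongrightarrow> x"
    using tendsto_diff[OF tendsto_const lim_1_over_n, of x] by simp
qed simp

text \<open>Apply reflected simple approximations of \<open>P\<close> to grid approximations of
  \<open>w\<close>. Operator application takes pairs of simple functions to simple functions and is
  jointly continuous, so the limits combine.\<close>

lemma strongly_measurable_convolution:
  fixes P :: "real \<Rightarrow> 'a::real_normed_vector \<Rightarrow>\<^sub>L 'b::real_normed_vector"
  assumes P: "strongly_measurable (lebesgue_on {0<..<t}) P" and w: "continuous_on {0..t} w"
  shows "strongly_measurable (lebesgue_on {0..t}) (\<lambda>s. blinfun_apply (P (t - s)) (w s))"
proof -
  obtain p where p: "\<And>i::nat. simple_function (lebesgue_on {0<..<t}) (p i)"
      "AE x in lebesgue_on {0<..<t}. (\<lambda>i. p i x) \<longlonglongrightarrow> P x"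
    using P unfolding strongly_measurable_def by auto
  \<comment> \<open>Extending \<open>p i\<close> by zero makes it simple on the whole line, where it
    can be composed with the reflection before restricting to \<open>{0..t}\<close>.\<close>
  define q where "q i s = (indicator {0<..<t} (t - s) *\<^sub>R p i (t - s))" for i s
  define v where "v i s = w (real_of_int \<lfloor>real i * s\<rfloor> / real i)" for i s
  have "simple_function lebesgue (\<lambda>s. indicator {0<..<t} s *\<^sub>R p i s)" for i
    using p(1)[of i] by (simp add: simple_function_restrict_space)
  from simple_function_compose_measurable[OF lebesgue_measurable_reflect this]
  have "simple_function lebesgue (q i)" for i
    unfolding q_def[abs_def] .
  then have q: "simple_function (lebesgue_on {0..t}) (q i)" for i
    by (intro simple_function_compose_measurable[OF _ \<open>simple_function lebesgue (q i)\<close>, of "\<lambda>x. x" "lebesgue_on {0..t}"])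
       (simp add: measurable_restrict_space1)
  have v: "simple_function (lebesgue_on {0..t}) (v i)" for i
    unfolding v_def[abs_def] by (rule simple_function_compose1[OF simple_function_floor])
  have vlim: "(\<lambda>i. v i s) \<longlonglongrightarrow> w s" if s: "s \<in> {0..t}" for s
    unfolding v_def
  proof (rule continuous_on_tendsto_compose[OF w floor_approx s])
    \<comment> \<open>Rounding down keeps the grid point between 0 and s; at i = 0 the quotient is 0
      by the convention for division.\<close>
    have "real_of_int \<lfloor>real i * s\<rfloor> / real i \<in> {0..t}" for i
    proof -
      have "real_of_int \<lfloor>real i * s\<rfloor> / real i \<le> s" using s by (cases "i = 0") (auto simp: field_simps)
      with s show ?thesis by auto
    qed
    then show "\<forall>\<^sub>F i in sequentially. real_of_int \<lfloor>real i * s\<rfloor> / real i \<in> {0..t}" by simp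
  qed
  have "AE x in lebesgue. x \<in> {0<..<t} \<longrightarrow> (\<lambda>i. p i x) \<longlonglongrightarrow> P x"
    using p(2) by (simp add: AE_restrict_space_iff)
  then have plim: "AE s in lebesgue. t - s \<in> {0<..<t} \<longrightarrow> (\<lambda>i. p i (t - s)) \<longlonglongrightarrow> P (t - s)"
    by (rule AE_lebesgue_reflect)
  \<comment> \<open>The approximation of \<open>P\<close> is known only on the open interval, which
    t - s leaves exactly at the two endpoints.\<close>
  have "negligible {0, t}" by auto
  then have "AE s in lebesgue. s \<notin> {0, t}"
    unfolding negligible_iff_null_sets by (rule AE_not_in)
  with plim have "AE s in lebesgue. s \<in> {0..t} \<longrightarrow> (\<lambda>i. blinfun_apply (q i s) (v i s)) \<longlonglongrightarrow> blinfun_apply (P (t - s)) (w s)"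
  proof eventually_elim
    case (elim s)
    show ?case
    proof
      assume s: "s \<in> {0..t}"
      with elim have "t - s \<in> {0<..<t}" by auto
      with elim have "(\<lambda>i. q i s) \<longlonglongrightarrow> P (t - s)" by (simp add: q_def)
      then show "(\<lambda>i. blinfun_apply (q i s) (v i s)) \<longlonglongrightarrow> blinfun_apply (P (t - s)) (w s)"
        using vlim[OF s] by (rule blinfun.tendsto)
    qed
  qed
  then have "AE s in lebesgue_on {0..t}. (\<lambda>i. blinfun_apply (q i s) (v i s)) \<longlonglongrightarrow> blinfun_apply (P (t - s)) (w s)"
    by (simp add: AE_restrict_space_iff)
  moreover have "simple_function (lebesgue_on {0..t}) (\<lambda>s. blinfun_apply (q i s) (v i s))" for i
    by (rule simple_function_compose2[OF q v])
  ultimately show ?thesis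
    unfolding strongly_measurable_def by (intro exI[of _ "\<lambda>i s. blinfun_apply (q i s) (v i s)"]) auto
qed

lemma has_integral_reflect_at:
  fixes f :: "real \<Rightarrow> 'b::real_normed_vector"
  assumes "(f has_integral I) {a..b}"
  shows "((\<lambda>s. f (t - s)) has_integral I) {t - b..t - a}"
proof -
  have "((\<lambda>s. f (- s)) has_integral I) (cbox (-b) (-a))"
    using assms by simp
  from has_integral_affinity'[OF this, of 1 "-t"] show ?thesis
    by (simp add: add.commute)
qed

lemma continuous_on_Icc_norm_bound:
  fixes w :: "real \<Rightarrow> 'b::real_normed_vector"
  assumes "continuous_on {a..b} w"
  shows "\<exists>C>0. \<forall>s\<in>{a..b}. norm (w s) \<le> C"
  using compact_imp_bounded[OF compact_continuous_image[OF assms compact_Icc]] by (simp add: bounded_pos)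

lemma norm_blinfun_apply_le: "norm x \<le> C \<Longrightarrow> norm (blinfun_apply f x) \<le> C * norm f"
  using norm_blinfun[of f x] mult_left_mono[of "norm x" C "norm f"] by (simp add: mult.commute)

section \<open>The convolution operator\<close>

locale mild_problem =
  fixes S P :: "real \<Rightarrow> 'a::banach \<Rightarrow>\<^sub>L 'a" and N :: "'a \<Rightarrow> 'a"
  assumes S_strongly_continuous: "\<And>x. continuous_on {0..} (\<lambda>t. blinfun_apply (S t) x)"
    and P_L1: "\<And>T. T > 0 \<Longrightarrow> bochner_L1 (lebesgue_on {0<..<T}) P"
    and N_lipschitz: "lipschitz_on_bounded_sets N"
begin

text \<open>Taken as a Henstock--Kurzweil integral for the sake of its calculus;
  \<open>conv_integrable\<close> identifies it with the strong Bochner integral when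
  \<open>w\<close> is continuous.\<close>

definition conv :: "(real \<Rightarrow> 'a) \<Rightarrow> real \<Rightarrow> 'a" where
  "conv w t = integral {0..t} (\<lambda>s. blinfun_apply (P (t - s)) (w s))"

definition G :: "real \<Rightarrow> real" where
  "G t = integral {0..t} (\<lambda>s. norm (P s))"

section \<open>The primitive of the kernel norm and bounds for the convolution\<close>

lemma norm_P_integrable: "(\<lambda>s. norm (P s)) integrable_on {a..b}" if "0 \<le> a"
proof (cases "0 < b")
  case True
  interpret complete_measure "lebesgue_on {0<..<b}" by (rule complete_measure_lebesgue_on) simp
  have "(\<lambda>s. norm (P s)) integrable_on {0<..<b}"
    by (rule nonneg_has_integral_lebesgue_on)
      (use P_L1[OF True] strongly_measurable_norm in \<open>auto simp: bochner_L1_def\<close>)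
  then have "(\<lambda>s. norm (P s)) integrable_on {0..b}"
    by (simp add: integrable_on_Icc_iff_Ioo)
  then show ?thesis
    by (rule integrable_subinterval_real) (use that in auto)
next
  \<comment> \<open>With \<open>a\<close> nonnegative and \<open>b\<close> nonpositive the interval
    is empty or the single point 0.\<close>
  case False
  then show ?thesis
    using that integrable_on_refl[of "\<lambda>s. norm (P s)" 0] by (cases "a = b") auto
qed

lemma G_0: "G 0 = 0"
  by (simp add: G_def)

lemma G_diff: "integral {a..b} (\<lambda>s. norm (P s)) = G b - G a" if "0 \<le> a" "a \<le> b"
  using Henstock_Kurzweil_Integration.integral_combine[OF that norm_P_integrable] unfolding G_def by simp

lemma G_mono: "G a \<le> G b" if "0 \<le> a" "a \<le> b"
  using G_diff[OF that] integral_nonneg[OF norm_P_integrable[OF that(1)], of b] by simp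

lemma G_nonneg: "0 \<le> G a" if "0 \<le> a"
  using G_mono[of 0 a] that G_0 by simp

lemma continuous_on_G: "continuous_on {0..T} G"
  unfolding G_def[abs_def] by (rule indefinite_integral_continuous_1) (rule norm_P_integrable, simp)

lemma norm_P_reflect_has_integral:
  assumes "0 \<le> a" "a \<le> b" "b \<le> t"
  shows "((\<lambda>s. norm (P (t - s))) has_integral (G (t - a) - G (t - b))) {a..b}"
proof -
  have "((\<lambda>s. norm (P s)) has_integral (G (t - a) - G (t - b))) {t - b..t - a}"
    using assms G_diff[of "t - b" "t - a"] norm_P_integrable[of "t - b" "t - a"] by (simp add: has_integral_iff)
  from has_integral_reflect_at[OF this, of t] show ?thesis by simp
qed

text \<open>A continuous \<open>w\<close> is bounded by some \<open>C\<close> on the compact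
  interval, so the integrand is dominated by \<open>C\<close> times the reflected kernel norm, whose
  integral is \<open>G t\<close>.\<close>

lemma bochner_L1_conv:
  assumes "0 \<le> t" "continuous_on {0..t} w"
  shows "bochner_L1 (lebesgue_on {0..t}) (\<lambda>s. blinfun_apply (P (t - s)) (w s))"
  unfolding bochner_L1_def
proof
  have "strongly_measurable (lebesgue_on {0<..<t}) P"
  proof (cases "0 < t")
    case True then show ?thesis using P_L1 unfolding bochner_L1_def by blast
  next
    \<comment> \<open>The hypothesis on \<open>P\<close> speaks of positive lengths only; here the
      underlying space is empty and constant approximations do.\<close>
    case False
    then have "simple_function (lebesgue_on {0<..<t}) (\<lambda>_. 0 :: 'a \<Rightarrow>\<^sub>L 'a)" "space (lebesgue_on {0<..<t}) = {}"
      by auto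
    then show ?thesis
      unfolding strongly_measurable_def by (intro exI[of _ "\<lambda>_ _. 0"] conjI allI AE_I2) auto
  qed
  then show "strongly_measurable (lebesgue_on {0..t}) (\<lambda>s. blinfun_apply (P (t - s)) (w s))"
    by (rule strongly_measurable_convolution[OF _ assms(2)])
  obtain C where "0 < C" and C: "\<And>s. s \<in> {0..t} \<Longrightarrow> norm (w s) \<le> C"
    using continuous_on_Icc_norm_bound[OF assms(2)] by blast
  then have "0 \<le> C" by simp
  have "(\<integral>\<^sup>+x. ennreal (norm (blinfun_apply (P (t - x)) (w x))) \<partial>lebesgue_on {0..t})
    \<le> (\<integral>\<^sup>+x. ennreal (norm (P (t - x)) * C) \<partial>lebesgue_on {0..t})"
  proof (intro nn_integral_mono ennreal_leI)
    fix x assume "x \<in> space (lebesgue_on {0..t})"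
    then have "norm (w x) \<le> C" using C by auto
    then show "norm (blinfun_apply (P (t - x)) (w x)) \<le> norm (P (t - x)) * C"
      by (simp add: norm_blinfun_apply_le mult.commute)
  qed
  also have "\<dots> = (\<integral>\<^sup>+x. ennreal (norm (P (t - x)) * C) * indicator {0..t} x \<partial>lborel)"
    by (simp add: nn_integral_restrict_space nn_integral_completion)
  also have "\<dots> = ennreal ((G (t - 0) - G (t - t)) * C)"
    by (rule nn_integral_has_integral_lebesgue')
      (use \<open>0 \<le> C\<close> assms norm_P_reflect_has_integral[of 0 t t] in \<open>auto intro!: has_integral_mult_left\<close>)
  also have "\<dots> < \<infinity>" by simp
  finally show "(\<integral>\<^sup>+x. ennreal (norm (blinfun_apply (P (t - x)) (w x))) \<partial>lebesgue_on {0..t}) < \<infinity>" .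
qed

text \<open>Makes the integrability clause of \<open>mild_solution\<close> automatic for continuous
  integrands and replaces its integral by \<open>conv\<close>.\<close>

lemma conv_integrable:
  assumes "0 \<le> t" "continuous_on {0..t} w"
  shows "strong_bochner_integrable (lebesgue_on {0..t}) (\<lambda>s. blinfun_apply (P (t - s)) (w s))"
    "(\<lambda>s. blinfun_apply (P (t - s)) (w s)) integrable_on {0..t}"
    "strong_bochner_integral (lebesgue_on {0..t}) (\<lambda>s. blinfun_apply (P (t - s)) (w s)) = conv w t"
  unfolding conv_def
  using bochner_L1_imp_strong_bochner_integrable[OF bochner_L1_conv[OF assms]]
  by (auto intro: strong_bochner_integral_eq_integral)

lemma conv_integrable_sub:
  assumes "0 \<le> a" "b \<le> t" "continuous_on {0..t} w"
  shows "(\<lambda>s. blinfun_apply (P (t - s)) (w s)) integrable_on {a..b}"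
proof (cases "a \<le> b")
  case True
  show ?thesis
    by (rule integrable_subinterval_real[OF conv_integrable(2)[of t]]) (use assms True in auto)
qed auto

lemma norm_conv_part_le:
  assumes "0 \<le> a" "a \<le> b" "b \<le> t" "continuous_on {0..t} w" "\<And>s. a \<le> s \<Longrightarrow> s \<le> b \<Longrightarrow> norm (w s) \<le> C"
  shows "norm (integral {a..b} (\<lambda>s. blinfun_apply (P (t - s)) (w s))) \<le> C * (G (t - a) - G (t - b))"
proof -
  note I = has_integral_mult_right[OF norm_P_reflect_has_integral[OF assms(1-3)], of C]
  have "norm (integral {a..b} (\<lambda>s. blinfun_apply (P (t - s)) (w s))) \<le> integral {a..b} (\<lambda>s. C * norm (P (t - s)))"
  proof (rule integral_norm_bound_integral)
    fix s assume "s \<in> {a..b}"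
    then have "norm (w s) \<le> C" using assms(5) by auto
    then show "norm (blinfun_apply (P (t - s)) (w s)) \<le> C * norm (P (t - s))"
      by (rule norm_blinfun_apply_le)
  qed (use I assms in \<open>auto intro!: conv_integrable_sub\<close>)
  also have "\<dots> = C * (G (t - a) - G (t - b))"
    using I by (rule integral_unique)
  finally show ?thesis .
qed

section \<open>Continuity of the convolution in time\<close>

lemma conv_reflect:
  assumes "0 \<le> t" "continuous_on {0..t} w"
  shows "((\<lambda>s. blinfun_apply (P s) (w (t - s))) has_integral conv w t) {0..t}"
  using has_integral_reflect_at[OF integrable_integral[OF conv_integrable(2)[OF assms]], of t]
  by (simp add: conv_def)

text \<open>By \<open>conv_reflect\<close> the time dependence sits in the continuous factor instead
  of the kernel. For t below t', the increment is the integral of P(s)(w(t' - s) - w(t - s)) over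
  [0,t], small by uniform continuity of \<open>w\<close>, plus the integral of P(s) w(t' - s) over
  [t,t'], small by uniform continuity of \<open>G\<close>.\<close>

lemma continuous_on_conv:
  assumes "0 \<le> T" "continuous_on {0..T} w"
  shows "continuous_on {0..T} (conv w)"
proof -
  have w: "continuous_on {0..t} w" if "t \<le> T" for t
    by (rule continuous_on_subset[OF assms(2)]) (use that in auto)
  obtain C where C: "C > 0" "\<And>s. s \<in> {0..T} \<Longrightarrow> norm (w s) \<le> C"
    using continuous_on_Icc_norm_bound[OF assms(2)] by blast
  have key: "\<exists>d>0. \<forall>t t'. 0 \<le> t \<and> t \<le> t' \<and> t' \<le> T \<and> t' - t < d \<longrightarrow> norm (conv w t' - conv w t) < e"
    if "e > 0" for e
  proof -
    \<comment> \<open>The added 1 keeps the denominator positive when \<open>G T\<close> is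
      0.\<close>
    define k where "k = e / (2 * (G T + 1))"
    have "G T \<ge> 0" using G_nonneg assms by auto
    then have k: "k > 0" using that by (simp add: k_def)
    have kG: "k * G T \<le> e/2" using that \<open>G T \<ge> 0\<close> unfolding k_def by (simp add: field_simps)
    have ek: "e / (2 * C) > 0" using \<open>e > 0\<close> \<open>C > 0\<close> by simp
    have "uniformly_continuous_on {0..T} w" "uniformly_continuous_on {0..T} G"
      using assms continuous_on_G by (auto intro!: compact_uniformly_continuous)
    note uc = this[unfolded uniformly_continuous_on_def, rule_format]
    obtain d1 where d1: "d1 > 0" "\<And>x y. x \<in> {0..T} \<Longrightarrow> y \<in> {0..T} \<Longrightarrow> dist x y < d1 \<Longrightarrow> dist (w x) (w y) < k"
      using uc(1)[OF k] by blast
    obtain d2 where d2: "d2 > 0" "\<And>x y. x \<in> {0..T} \<Longrightarrow> y \<in> {0..T} \<Longrightarrow> dist x y < d2 \<Longrightarrow> dist (G x) (G y) < e / (2 * C)"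
      using uc(2)[OF ek] by blast
    have "norm (conv w t' - conv w t) < e" if t: "0 \<le> t" "t \<le> t'" "t' \<le> T" "t' - t < min d1 d2" for t t'
    proof -
      let ?f = "\<lambda>s. blinfun_apply (P s) (w (t' - s))"
      let ?g = "\<lambda>s. blinfun_apply (P s) (w (t - s))"
      have f: "(?f has_integral conv w t') {0..t'}" using conv_reflect w t by auto
      have g: "(?g has_integral conv w t) {0..t}" using conv_reflect w t by auto
      have fi: "?f integrable_on {0..t'}" "?f integrable_on {0..t}" "?f integrable_on {t..t'}"
        using f t by (auto intro: integrable_subinterval_real[OF has_integral_integrable[OF f]])
      have "conv w t' = integral {0..t} ?f + integral {t..t'} ?f"
        using Henstock_Kurzweil_Integration.integral_combine[OF t(1,2) fi(1)] integral_unique[OF f] by simp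
      then have eq: "conv w t' - conv w t = integral {0..t} (\<lambda>s. ?f s - ?g s) + integral {t..t'} ?f"
        using fi g by (subst integral_diff) (auto simp: integral_unique)
      have "norm (integral {0..t} (\<lambda>s. ?f s - ?g s)) \<le> integral {0..t} (\<lambda>s. k * norm (P s))"
      proof (rule integral_norm_bound_integral)
        fix s assume s: "s \<in> {0..t}"
        then have "dist (w (t' - s)) (w (t - s)) < k" using t by (intro d1(2)) (auto simp: dist_real_def)
        then have "norm (w (t' - s) - w (t - s)) \<le> k" by (simp add: dist_norm)
        then show "norm (?f s - ?g s) \<le> k * norm (P s)"
          by (simp add: norm_blinfun_apply_le flip: blinfun.diff_right)
      qed (use fi g norm_P_integrable[of 0 t] in \<open>auto intro!: integrable_diff integrable_on_mult_right\<close>)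
      also have "\<dots> = k * G t" by (simp add: G_def)
      also have "\<dots> \<le> k * G T" using k G_mono[of t T] t by (simp)
      also note kG
      finally have 1: "norm (integral {0..t} (\<lambda>s. ?f s - ?g s)) \<le> e/2" .
      have "norm (integral {t..t'} ?f) \<le> integral {t..t'} (\<lambda>s. C * norm (P s))"
      proof (rule integral_norm_bound_integral)
        fix s assume s: "s \<in> {t..t'}"
        then have "norm (w (t' - s)) \<le> C" using t by (intro C) auto
        then show "norm (?f s) \<le> C * norm (P s)"
          by (rule norm_blinfun_apply_le)
      qed (use fi norm_P_integrable[of t t'] t in \<open>auto intro!: integrable_on_mult_right\<close>)
      also have "\<dots> = C * (G t' - G t)" using G_diff t by simp
      also have "\<dots> < C * (e / (2 * C))"
        using d2(2)[of t' t] t \<open>C > 0\<close> by (intro mult_strict_left_mono) (auto simp: dist_real_def)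
      also have "\<dots> = e / 2" using \<open>C > 0\<close> by simp
      finally show ?thesis
        using 1 norm_triangle_ineq[of "integral {0..t} (\<lambda>s. ?f s - ?g s)" "integral {t..t'} ?f"] unfolding eq by simp
    qed
    then show ?thesis using d1(1) d2(1) by (intro exI[of _ "min d1 d2"]) auto
  qed
  show ?thesis
    unfolding continuous_on_iff
  proof (intro ballI allI impI)
    fix x e assume x: "x \<in> {0..T}" and "e > (0::real)"
    then obtain d where d: "d > 0" "\<And>t t'. 0 \<le> t \<Longrightarrow> t \<le> t' \<Longrightarrow> t' \<le> T \<Longrightarrow> t' - t < d \<Longrightarrow> norm (conv w t' - conv w t) < e"
      using key by metis
    have "dist (conv w y) (conv w x) < e" if "y \<in> {0..T}" "dist y x < d" for y
      using that x d(2)[of x y] d(2)[of y x]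
      by (cases "x \<le> y") (auto simp: dist_norm norm_minus_commute)
    then show "\<exists>d>0. \<forall>y\<in>{0..T}. dist y x < d \<longrightarrow> dist (conv w y) (conv w x) < e"
      using d(1) by blast
  qed
qed

section \<open>Bounds for the nonlinearity and the contraction estimate\<close>

lemma N_lipschitz_const:
  obtains L where "L > 0" "\<And>u v. norm u \<le> R \<Longrightarrow> norm v \<le> R \<Longrightarrow> norm (N u - N v) \<le> L * norm (u - v)"
proof -
  have "max R 1 > 0" by simp
  then obtain L where L: "\<And>u v. norm u \<le> max R 1 \<Longrightarrow> norm v \<le> max R 1 \<Longrightarrow> norm (N u - N v) \<le> L * norm (u - v)"
    using N_lipschitz unfolding lipschitz_on_bounded_sets_def by blast
  \<comment> \<open>Enlarging the radius and the constant to at least 1 allows any real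
    \<open>R\<close> and gives a positive \<open>L\<close> to divide by.\<close>
  show thesis
  proof (rule that[of "max L 1"])
    fix u v :: 'a assume "norm u \<le> R" "norm v \<le> R"
    then have "norm (N u - N v) \<le> L * norm (u - v)" by (intro L) auto
    also have "\<dots> \<le> max L 1 * norm (u - v)" by (intro mult_right_mono) auto
    finally show "norm (N u - N v) \<le> max L 1 * norm (u - v)" .
  qed simp
qed

lemma N_bounded:
  obtains C where "C > 0" "\<And>u. norm u \<le> R \<Longrightarrow> norm (N u) \<le> C"
proof -
  \<comment> \<open>The absolute value keeps 0, the point of comparison, inside the ball for every
    \<open>R\<close>.\<close>
  obtain L where L: "L > 0" "\<And>u v. norm u \<le> \<bar>R\<bar> \<Longrightarrow> norm v \<le> \<bar>R\<bar> \<Longrightarrow> norm (N u - N v) \<le> L * norm (u - v)"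
    using N_lipschitz_const[of "\<bar>R\<bar>"] by blast
  show thesis
  proof (rule that[of "norm (N 0) + L * \<bar>R\<bar> + 1"])
    fix u :: 'a assume u: "norm u \<le> R"
    then have "norm (N u - N 0) \<le> L * norm (u - 0)" by (intro L) auto
    also have "\<dots> \<le> L * \<bar>R\<bar>" using L u by (intro mult_left_mono) auto
    finally show "norm (N u) \<le> norm (N 0) + L * \<bar>R\<bar> + 1"
      using norm_triangle_ineq2[of "N u" "N 0"] by simp
  qed (use L(1) in \<open>auto intro!: add_nonneg_pos\<close>)
qed

lemma continuous_on_N: "continuous_on UNIV N"
  unfolding continuous_on_iff
proof (intro ballI allI impI)
  fix x :: 'a and e :: real assume "e > 0"
  obtain L where L: "L > 0" "\<And>u v. norm u \<le> norm x + 1 \<Longrightarrow> norm v \<le> norm x + 1 \<Longrightarrow> norm (N u - N v) \<le> L * norm (u - v)"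
    using N_lipschitz_const[of "norm x + 1"] by blast
  have "dist (N y) (N x) < e" if "dist y x < min 1 (e / L)" for y :: 'a
  proof -
    have "norm y \<le> norm x + 1" using that norm_triangle_ineq2[of y x] by (simp add: dist_norm)
    then have "norm (N y - N x) \<le> L * norm (y - x)" by (intro L) auto
    also have "\<dots> < e" using that L(1) by (simp add: dist_norm field_simps)
    finally show ?thesis by (simp add: dist_norm)
  qed
  then show "\<exists>d>0. \<forall>y\<in>UNIV. dist y x < d \<longrightarrow> dist (N y) (N x) < e"
    using \<open>e > 0\<close> L(1) by (intro exI[of _ "min 1 (e / L)"]) auto
qed

lemma continuous_on_N_compose: "continuous_on A v \<Longrightarrow> continuous_on A (\<lambda>s. N (v s))"
  using continuous_on_compose2[OF continuous_on_N] by auto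

text \<open>The bound \<open>d \<le> 1\<close> later keeps an extended interval inside [0, T0 + 1],
  where the a priori bounds are taken.\<close>

lemma G_small:
  assumes "e > 0"
  obtains d where "0 < d" "d \<le> 1" "\<And>h. 0 \<le> h \<Longrightarrow> h \<le> d \<Longrightarrow> G h < e"
proof -
  obtain d where d: "d > 0" "\<And>h. h \<in> {0..1} \<Longrightarrow> dist h 0 < d \<Longrightarrow> dist (G h) (G 0) < e"
    using continuous_on_G[of 1] assms unfolding continuous_on_iff by (metis atLeastAtMost_iff order_refl zero_le_one)
  show thesis
  proof (rule that[of "min (d/2) 1"])
    fix h assume "0 \<le> h" "h \<le> min (d/2) 1"
    then show "G h < e" using d(2)[of h] d(1) G_0 by (auto simp: dist_real_def)
  qed (use d(1) in auto)
qed

text \<open>Agreement up to \<open>a\<close> removes that part of the integral. What is left sees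
  the kernel only at arguments in [0, t - a], so the factor depends on the length of the step and
  not on its position.\<close>

lemma conv_N_diff_le:
  assumes a: "0 \<le> a" "a \<le> t"
    and cont: "continuous_on {0..t} u" "continuous_on {0..t} v"
    and eq: "\<And>s. 0 \<le> s \<Longrightarrow> s \<le> a \<Longrightarrow> u s = v s"
    and bd: "\<And>s. 0 \<le> s \<Longrightarrow> s \<le> t \<Longrightarrow> norm (u s) \<le> R" "\<And>s. 0 \<le> s \<Longrightarrow> s \<le> t \<Longrightarrow> norm (v s) \<le> R"
    and L: "0 \<le> L" "\<And>x y. norm x \<le> R \<Longrightarrow> norm y \<le> R \<Longrightarrow> norm (N x - N y) \<le> L * norm (x - y)"
    and m: "\<And>s. a \<le> s \<Longrightarrow> s \<le> t \<Longrightarrow> norm (u s - v s) \<le> m"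
  shows "norm (conv (\<lambda>s. N (u s)) t - conv (\<lambda>s. N (v s)) t) \<le> L * m * G (t - a)"
proof -
  let ?w = "\<lambda>s. N (u s) - N (v s)"
  have w: "continuous_on {0..t} ?w"
    using cont by (intro continuous_intros continuous_on_N_compose)
  have "0 \<le> t" using a by simp
  have "conv (\<lambda>s. N (u s)) t - conv (\<lambda>s. N (v s)) t = integral {0..t} (\<lambda>s. blinfun_apply (P (t - s)) (?w s))"
    unfolding conv_def blinfun.diff_right
    by (rule integral_diff[symmetric]) (intro conv_integrable(2) continuous_on_N_compose cont \<open>0 \<le> t\<close>)+
  also have "\<dots> = integral {0..a} (\<lambda>s. blinfun_apply (P (t - s)) (?w s)) + integral {a..t} (\<lambda>s. blinfun_apply (P (t - s)) (?w s))"
    using Henstock_Kurzweil_Integration.integral_combine[OF a conv_integrable(2)[OF \<open>0 \<le> t\<close> w]] by simp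
  \<comment> \<open>The bound on a part of the convolution is used with constant 0, since the
    integrand vanishes where \<open>u\<close> and \<open>v\<close> agree.\<close>
  also have "integral {0..a} (\<lambda>s. blinfun_apply (P (t - s)) (?w s)) = 0"
    using norm_conv_part_le[of 0 a t ?w 0] a w eq by simp
  also have "norm (0 + integral {a..t} (\<lambda>s. blinfun_apply (P (t - s)) (?w s))) \<le> L * m * (G (t - a) - G (t - t))"
    unfolding add_0
  proof (rule norm_conv_part_le)
    fix s assume s: "a \<le> s" "s \<le> t"
    have "norm (?w s) \<le> L * norm (u s - v s)" using s a by (intro L bd) auto
    also have "\<dots> \<le> L * m" using s L m by (intro mult_left_mono) auto
    finally show "norm (?w s) \<le> L * m" .
  qed (use a w in auto)
  finally show ?thesis by (simp add: G_0)
qed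

section \<open>Solutions on compact intervals\<close>

definition sol :: "'a \<Rightarrow> real \<Rightarrow> (real \<Rightarrow> 'a) \<Rightarrow> bool" where
  "sol u0 T v \<longleftrightarrow> continuous_on {0..T} v \<and>
     (\<forall>t\<in>{0..T}. v t = blinfun_apply (S t) u0 + conv (\<lambda>s. N (v s)) t)"

lemma sol_mono: "sol u0 T v \<Longrightarrow> t \<le> T \<Longrightarrow> sol u0 t v"
  unfolding sol_def by (auto intro: continuous_on_subset)

lemma conv_cong: "(\<And>s. 0 \<le> s \<Longrightarrow> s \<le> t \<Longrightarrow> w s = w' s) \<Longrightarrow> conv w t = conv w' t"
  unfolding conv_def by (rule Henstock_Kurzweil_Integration.integral_cong) auto

lemma sol_cong:
  assumes "sol u0 T v" "\<And>s. 0 \<le> s \<Longrightarrow> s \<le> T \<Longrightarrow> u s = v s"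
  shows "sol u0 T u"
  unfolding sol_def
proof
  show "continuous_on {0..T} u"
    using assms continuous_on_cong[of "{0..T}" "{0..T}" u v] unfolding sol_def by auto
  show "\<forall>t\<in>{0..T}. u t = blinfun_apply (S t) u0 + conv (\<lambda>s. N (u s)) t"
  proof
    fix t assume t: "t \<in> {0..T}"
    then have "conv (\<lambda>s. N (u s)) t = conv (\<lambda>s. N (v s)) t"
      by (intro conv_cong) (auto simp: assms(2))
    with t assms show "u t = blinfun_apply (S t) u0 + conv (\<lambda>s. N (u s)) t"
      unfolding sol_def by auto
  qed
qed

lemma sol_0: "sol u0 0 (\<lambda>_. blinfun_apply (S 0) u0)"
  by (simp add: sol_def conv_def)

text \<open>Choose \<open>d\<close> with L G(h) < 1 for all h up to \<open>d\<close>. Once the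
  solutions agree up to \<open>a\<close>, their greatest distance m on the next step satisfies m
  \<le> L m G(x - a), which forces m = 0; finitely many steps reach T.\<close>

lemma sol_unique:
  assumes u: "sol u0 T u" and v: "sol u0 T v" and t: "t \<in> {0..T}"
  shows "u t = v t"
proof -
  have cont: "continuous_on {0..T} u" "continuous_on {0..T} v"
    using u v by (auto simp: sol_def)
  obtain R1 R2 where "\<forall>s\<in>{0..T}. norm (u s) \<le> R1" "\<forall>s\<in>{0..T}. norm (v s) \<le> R2"
    using cont[THEN continuous_on_Icc_norm_bound] by blast
  then have R: "\<And>s. s \<in> {0..T} \<Longrightarrow> norm (u s) \<le> max R1 R2" "\<And>s. s \<in> {0..T} \<Longrightarrow> norm (v s) \<le> max R1 R2"
    by (auto simp: le_max_iff_disj)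
  obtain L where L: "L > 0" "\<And>x y. norm x \<le> max R1 R2 \<Longrightarrow> norm y \<le> max R1 R2 \<Longrightarrow> norm (N x - N y) \<le> L * norm (x - y)"
    using N_lipschitz_const by blast
  obtain d where d: "0 < d" "\<And>h. 0 \<le> h \<Longrightarrow> h \<le> d \<Longrightarrow> G h < 1 / L"
    using G_small[of "1 / L"] L(1) by auto
  have eq: "\<forall>s. 0 \<le> s \<and> s \<le> T \<and> s \<le> real n * d \<longrightarrow> u s = v s" for n
  proof (induction n)
    case 0
    then show ?case using u v by (auto simp: sol_def conv_def)
  next
    case (Suc n)
    define a where "a = real n * d"
    define b where "b = min T (real (Suc n) * d)"
    have "a \<ge> 0" using d by (simp add: a_def)
    show ?case
    proof (intro allI impI)
      fix s assume s: "0 \<le> s \<and> s \<le> T \<and> s \<le> real (Suc n) * d"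
      show "u s = v s"
      proof (cases "s \<le> a")
        case True
        with s Suc show ?thesis by (simp add: a_def)
      next
        case False
        then have sab: "s \<in> {a..b}" using s by (simp add: b_def)
        have sub: "{a..b} \<subseteq> {0..T}" using \<open>a \<ge> 0\<close> by (auto simp: b_def)
        have "continuous_on {a..b} (\<lambda>s. norm (u s - v s))"
          by (intro continuous_intros continuous_on_subset[OF cont(1) sub] continuous_on_subset[OF cont(2) sub])
        \<comment> \<open>The estimate is evaluated at a point where the distance is greatest, so
          that the same number stands on both sides.\<close>
        then obtain x where x: "x \<in> {a..b}" and max: "\<And>y. y \<in> {a..b} \<Longrightarrow> norm (u y - v y) \<le> norm (u x - v x)"
          using continuous_attains_sup[of "{a..b}" "\<lambda>s. norm (u s - v s)"] sab by auto
        let ?m = "norm (u x - v x)"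
        have xT: "x \<in> {0..T}" using x sub by auto
        have "u x - v x = conv (\<lambda>s. N (u s)) x - conv (\<lambda>s. N (v s)) x"
          using u v xT by (auto simp: sol_def)
        also have "norm \<dots> \<le> L * ?m * G (x - a)"
        proof (rule conv_N_diff_le[where R="max R1 R2"])
          show "continuous_on {0..x} u" "continuous_on {0..x} v"
            using xT by (auto intro: continuous_on_subset[OF cont(1)] continuous_on_subset[OF cont(2)])
          show "u s = v s" if "0 \<le> s" "s \<le> a" for s
            using that Suc x xT by (auto simp: a_def)
          show "norm (N x - N y) \<le> L * norm (x - y)" if "norm x \<le> max R1 R2" "norm y \<le> max R1 R2" for x y
            using that by (rule L)
        qed (use \<open>a \<ge> 0\<close> x xT R L(1) max in auto)
        finally have le: "?m \<le> L * ?m * G (x - a)" .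
        have "G (x - a) < 1 / L"
          using x by (intro d(2)) (auto simp: a_def b_def algebra_simps)
        then have "L * G (x - a) < 1" using L(1) by (simp add: field_simps)
        have "?m = 0"
        proof (rule ccontr)
          assume "?m \<noteq> 0"
          then have "?m > 0" by simp
          then have "?m * (L * G (x - a)) < ?m * 1"
            using \<open>L * G (x - a) < 1\<close> by (intro mult_strict_left_mono)
          with le show False by (simp add: algebra_simps)
        qed
        with max[OF sab] show ?thesis by simp
      qed
    qed
  qed
  obtain n where "T \<le> real n * d"
    using reals_Archimedean3[OF d(1)] less_imp_le by blast
  then show ?thesis using eq[of n] t by auto
qed

text \<open>The fixed point problem is posed on all of [0, t0 + d] with the values on [0,t0]
  prescribed, so no restarted problem is involved; this suits a general \<open>S\<close> without the
  semigroup law. For given \<open>u0\<close>, all constants come from \<open>R\<close> and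
  \<open>T0\<close>, so \<open>d\<close> serves every \<open>t0\<close> and
  \<open>u\<close>.\<close>

lemma sol_extend_uniform:
  assumes "0 \<le> T0"
  obtains d where "d > 0"
    "\<And>t0 u. 0 \<le> t0 \<Longrightarrow> t0 \<le> T0 \<Longrightarrow> sol u0 t0 u \<Longrightarrow> (\<And>t. t \<in> {0..t0} \<Longrightarrow> norm (u t) \<le> R) \<Longrightarrow> \<exists>v. sol u0 (t0 + d) v"
proof -
  obtain C where C: "C > 0" "\<And>u. norm u \<le> R \<Longrightarrow> norm (N u) \<le> C"
    using N_bounded by blast
  have Sc: "continuous_on {0..T} (\<lambda>t. blinfun_apply (S t) u0)" for T
    by (rule continuous_on_subset[OF S_strongly_continuous]) auto
  obtain M where M: "M > 0" "\<And>t. t \<in> {0..T0 + 1} \<Longrightarrow> norm (blinfun_apply (S t) u0) \<le> M"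
    using continuous_on_Icc_norm_bound[OF Sc] by blast
  \<comment> \<open>\<open>M\<close> bounds the free term, \<open>C * G (T0 + 1)\<close> the
    contribution of the old stretch [0,t0], and 1 that of the new stretch once \<open>d\<close> is
    chosen. The maximum with \<open>R\<close> admits \<open>u\<close> itself.\<close>
  define R' where "R' = max R (M + C * G (T0 + 1) + 1)"
  obtain C' where C': "C' > 0" "\<And>u. norm u \<le> R' \<Longrightarrow> norm (N u) \<le> C'"
    using N_bounded by blast
  obtain L where L: "L > 0" "\<And>x y. norm x \<le> R' \<Longrightarrow> norm y \<le> R' \<Longrightarrow> norm (N x - N y) \<le> L * norm (x - y)"
    using N_lipschitz_const by blast
  \<comment> \<open>The bound 1/C' makes the new contribution at most 1, so the ball of radius
    \<open>R'\<close> is preserved; 1/(2L) makes the map a contraction with factor 1/2.\<close>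
  obtain d where d: "0 < d" "d \<le> 1" "\<And>h. 0 \<le> h \<Longrightarrow> h \<le> d \<Longrightarrow> G h < min (1 / C') (1 / (2 * L))"
    using G_small[of "min (1 / C') (1 / (2 * L))"] L(1) C'(1) by auto
  have "\<exists>v. sol u0 (t0 + d) v" if t0: "0 \<le> t0" "t0 \<le> T0" and u: "sol u0 t0 u"
    and uR: "\<And>t. t \<in> {0..t0} \<Longrightarrow> norm (u t) \<le> R" for t0 u
  proof -
    define T where "T = t0 + d"
    have T: "t0 \<le> T" "0 \<le> T" "T \<le> T0 + 1" using d t0 by (auto simp: T_def)
    define X where "X = PiC UNIV (\<lambda>t. if t \<in> {0..t0} then {u t} else cball 0 R')"
    define F where "F v t = blinfun_apply (S t) u0 + conv (\<lambda>s. N (v s)) t" for v t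
    \<comment> \<open>Bounded continuous functions live on the whole line; clamping time to
      \<open>{0..T}\<close> extends the image by constants.\<close>
    define \<Phi> where "\<Phi> v = Bcontfun (\<lambda>t. F (apply_bcontfun v) (max 0 (min T t)))" for v
    have X_eq: "apply_bcontfun v t = u t" if "v \<in> X" "t \<in> {0..t0}" for v t
      using Pi_mem[OF mem_PiCD[OF that(1)[unfolded X_def]], of t] that(2) by simp
    have X_norm: "norm (apply_bcontfun v t) \<le> R'" if "v \<in> X" for v t
    proof (cases "t \<in> {0..t0}")
      case True
      with uR[OF True] X_eq[OF that True] show ?thesis by (simp add: R'_def)
    next
      case False
      with Pi_mem[OF mem_PiCD[OF that(1)[unfolded X_def]], of t] show ?thesis by auto
    qed
    have XI: "v \<in> X" if "\<And>t. t \<in> {0..t0} \<Longrightarrow> apply_bcontfun v t = u t" "\<And>t. norm (apply_bcontfun v t) \<le> R'" for v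
      unfolding X_def by (rule mem_PiCI) (use that in auto)
    have F_u: "F (apply_bcontfun v) t = u t" if "v \<in> X" "t \<in> {0..t0}" for v t
    proof -
      have "conv (\<lambda>s. N (apply_bcontfun v s)) t = conv (\<lambda>s. N (u s)) t"
        by (rule conv_cong) (use that X_eq in auto)
      then show ?thesis using u that unfolding F_def sol_def by auto
    qed
    have F_cont: "continuous_on {0..T} (F (apply_bcontfun v))" for v
      unfolding F_def by (intro continuous_on_add Sc continuous_on_conv T continuous_on_N_compose) auto
    have F_norm: "norm (F (apply_bcontfun v) t) \<le> R'" if v: "v \<in> X" and t: "t \<in> {0..T}" for v t
    proof (cases "t \<le> t0")
      case True
      with t have "t \<in> {0..t0}" by simp
      with F_u[OF v this] uR[OF this] show ?thesis by (simp add: R'_def)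
    next
      case False
      let ?w = "\<lambda>s. N (apply_bcontfun v s)"
      let ?f = "\<lambda>s. blinfun_apply (P (t - s)) (?w s)"
      have w: "continuous_on {0..t} ?w" by (intro continuous_on_N_compose) auto
      \<comment> \<open>On the old stretch the sharper bound \<open>C\<close> from \<open>R\<close>
        is essential: using \<open>C'\<close> here would be circular, because \<open>C'\<close> is
        chosen after \<open>R'\<close>.\<close>
      have "norm (integral {0..t0} ?f) \<le> C * (G (t - 0) - G (t - t0))"
        by (rule norm_conv_part_le) (use False w t0 C uR X_eq[OF v] in auto)
      also have "\<dots> \<le> C * G (T0 + 1)"
        using C(1) G_mono[of t "T0 + 1"] G_nonneg[of "t - t0"] t T False by (intro mult_left_mono) auto
      finally have 1: "norm (integral {0..t0} ?f) \<le> C * G (T0 + 1)" .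
      have "norm (integral {t0..t} ?f) \<le> C' * (G (t - t0) - G (t - t))"
        by (rule norm_conv_part_le) (use False w t0 C'(2) X_norm[OF v] in auto)
      also have "\<dots> \<le> C' * (1 / C')"
        using d(3)[of "t - t0"] t False C'(1) G_0 by (intro mult_left_mono) (auto simp: T_def)
      also have "\<dots> = 1" using C'(1) by simp
      finally have 2: "norm (integral {t0..t} ?f) \<le> 1" .
      have "conv ?w t = integral {0..t0} ?f + integral {t0..t} ?f"
        unfolding conv_def using False t0 w
        by (intro Henstock_Kurzweil_Integration.integral_combine[symmetric] conv_integrable(2)) auto
      then have "norm (conv ?w t) \<le> C * G (T0 + 1) + 1"
        using 1 2 norm_triangle_ineq[of "integral {0..t0} ?f" "integral {t0..t} ?f"] by simp
      moreover have "norm (blinfun_apply (S t) u0) \<le> M" using M t T by auto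
      ultimately have "norm (F (apply_bcontfun v) t) \<le> M + C * G (T0 + 1) + 1"
        unfolding F_def using norm_triangle_ineq[of "blinfun_apply (S t) u0" "conv ?w t"] by simp
      then show ?thesis by (simp add: R'_def)
    qed
    have clamp: "max 0 (min T t) \<in> {0..T}" for t using T by auto
    have \<Phi>: "apply_bcontfun (\<Phi> v) t = F (apply_bcontfun v) (max 0 (min T t))" if v: "v \<in> X" for v t
    proof -
      have "(\<lambda>t. F (apply_bcontfun v) (max 0 (min T t))) \<in> bcontfun"
      proof (rule bcontfun_normI)
        show "continuous_on UNIV (\<lambda>t. F (apply_bcontfun v) (max 0 (min T t)))"
          by (rule continuous_on_compose2[OF F_cont]) (use clamp in \<open>auto intro!: continuous_intros\<close>)
        show "norm (F (apply_bcontfun v) (max 0 (min T t))) \<le> R'" for t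
          by (rule F_norm[OF v clamp])
      qed
      then show ?thesis unfolding \<Phi>_def by (simp add: Bcontfun_inverse)
    qed
    have "\<exists>!v\<in>X. \<Phi> v = v"
    proof (rule Banach_fix[of _ "1/2"])
      show "complete X"
        unfolding complete_eq_closed X_def by (rule closed_PiC) auto
      \<comment> \<open>Freezing \<open>u\<close> at its end values shows that \<open>X\<close> is
        nonempty.\<close>
      have "(\<lambda>t. u (max 0 (min t0 t))) \<in> bcontfun"
      proof (rule bcontfun_normI)
        show "continuous_on UNIV (\<lambda>t. u (max 0 (min t0 t)))"
          by (rule continuous_on_compose2[of "{0..t0}" u]) (use u t0 in \<open>auto simp: sol_def intro!: continuous_intros\<close>)
        show "norm (u (max 0 (min t0 t))) \<le> R" for t
          by (rule uR) (use t0 in auto)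
      qed
      then have v0: "apply_bcontfun (Bcontfun (\<lambda>t. u (max 0 (min t0 t)))) = (\<lambda>t. u (max 0 (min t0 t)))"
        by (rule Bcontfun_inverse)
      have "Bcontfun (\<lambda>t. u (max 0 (min t0 t))) \<in> X"
      proof (rule XI; unfold v0)
        fix t
        have "norm (u (max 0 (min t0 t))) \<le> R" by (rule uR) (use t0 in auto)
        then show "norm (u (max 0 (min t0 t))) \<le> R'" by (simp add: R'_def)
      qed auto
      then show "X \<noteq> {}" by blast
      show "\<Phi> ` X \<subseteq> X"
      proof clarify
        fix v assume v: "v \<in> X"
        show "\<Phi> v \<in> X"
          by (rule XI; unfold \<Phi>[OF v]) (use F_u[OF v] F_norm[OF v clamp] T t0 in auto)
      qed
      fix v v' assume v: "v \<in> X" "v' \<in> X"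
      show "dist (\<Phi> v) (\<Phi> v') \<le> 1/2 * dist v v'"
      proof (rule dist_bound)
        fix t
        define \<tau> where "\<tau> = max 0 (min T t)"
        have \<tau>: "\<tau> \<in> {0..T}" unfolding \<tau>_def by (rule clamp)
        show "dist (apply_bcontfun (\<Phi> v) t) (apply_bcontfun (\<Phi> v') t) \<le> 1/2 * dist v v'"
        proof (cases "\<tau> \<le> t0")
          case True
          then show ?thesis using \<tau> F_u[OF v(1), of \<tau>] F_u[OF v(2), of \<tau>] by (simp add: \<Phi> v flip: \<tau>_def)
        next
          case False
          have "dist (apply_bcontfun (\<Phi> v) t) (apply_bcontfun (\<Phi> v') t)
            = norm (conv (\<lambda>s. N (apply_bcontfun v s)) \<tau> - conv (\<lambda>s. N (apply_bcontfun v' s)) \<tau>)"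
            by (simp add: \<Phi> v F_def dist_norm flip: \<tau>_def)
          also have "\<dots> \<le> L * dist v v' * G (\<tau> - t0)"
          proof (rule conv_N_diff_le[where R=R'])
            show "norm (N x - N y) \<le> L * norm (x - y)" if "norm x \<le> R'" "norm y \<le> R'" for x y
              using that by (rule L)
            show "norm (apply_bcontfun v s - apply_bcontfun v' s) \<le> dist v v'" for s
              using dist_bounded[of v s v'] by (simp add: dist_norm)
          qed (use t0 False L(1) X_norm v X_eq in auto)
          also have "\<dots> \<le> L * dist v v' * (1 / (2 * L))"
            using d(3)[of "\<tau> - t0"] \<tau> False L(1) by (intro mult_left_mono) (auto simp: T_def)
          also have "\<dots> = 1/2 * dist v v'" using L(1) by simp
          finally show ?thesis .
        qed
      qed
    qed auto
    then obtain v where v: "v \<in> X" "\<Phi> v = v" by blast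
    have "sol u0 T (apply_bcontfun v)"
      unfolding sol_def
    proof (intro conjI ballI)
      fix t assume "t \<in> {0..T}"
      then have "max 0 (min T t) = t" by auto
      then show "apply_bcontfun v t = blinfun_apply (S t) u0 + conv (\<lambda>s. N (apply_bcontfun v s)) t"
        using \<Phi>[OF v(1), of t] v(2) by (simp add: F_def)
    qed auto
    then show ?thesis unfolding T_def by blast
  qed
  then show thesis using that d(1) by blast
qed

section \<open>Reduction of mild solutions to compact intervals\<close>

lemma mild_solution_iff:
  "mild_solution S P N u0 J u \<longleftrightarrow> time_interval J \<and> (\<forall>t\<in>J. sol u0 t u)"
proof (cases "time_interval J")
  case J: True
  have J0: "0 \<le> t" "{0..t} \<subseteq> J" if "t \<in> J" for t
    using J that unfolding time_interval_def half_open_interval_def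
    by (auto intro: le_less_trans[of "ereal _" "ereal _"])
  show ?thesis
  proof
    assume u: "mild_solution S P N u0 J u"
    have "sol u0 t u" if t: "t \<in> J" for t
      unfolding sol_def
    proof (intro conjI ballI)
      show c: "continuous_on {0..t} u"
        using u J0[OF t] unfolding mild_solution_def by (auto intro: continuous_on_subset)
      fix s assume s: "s \<in> {0..t}"
      then have "continuous_on {0..s} (\<lambda>s. N (u s))"
        by (intro continuous_on_N_compose continuous_on_subset[OF c]) auto
      from conv_integrable(3)[OF _ this] s J0(2)[OF t] u
      show "u s = blinfun_apply (S s) u0 + conv (\<lambda>s. N (u s)) s"
        unfolding mild_solution_def by auto
    qed
    with J show "time_interval J \<and> (\<forall>t\<in>J. sol u0 t u)" by blast
  next
    assume "time_interval J \<and> (\<forall>t\<in>J. sol u0 t u)"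
    then have sol: "\<And>t. t \<in> J \<Longrightarrow> sol u0 t u" by blast
    have "continuous_on J u"
      using J unfolding time_interval_def
    proof (elim disjE exE conjE)
      fix T :: real assume "0 < T" "J = {0..T}"
      with sol[of T] show ?thesis by (simp add: sol_def)
    next
      fix T :: ereal assume T: "0 < T" "J = half_open_interval T"
      show ?thesis
        unfolding continuous_on_eq_continuous_within
      proof
        fix x assume x: "x \<in> J"
        then have "ereal x < T" using T by (simp add: half_open_interval_def)
        \<comment> \<open>Continuity is local: near x the half-open interval coincides with the
          compact interval \<open>{0..y}\<close>, on which \<open>u\<close> is known to be
          continuous.\<close>
        then obtain y where y: "x < y" "ereal y < T"
          by (metis ereal_dense2 ereal_less_eq(3) less_ereal.simps(1))
        then have "y \<in> J" using x T by (auto simp: half_open_interval_def)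
        then have "continuous (at x within {0..y}) u"
          using sol[of y] x y J0(1)[OF x] by (auto simp: sol_def continuous_on_eq_continuous_within)
        moreover have "at x within J = at x within {0..y}"
          by (rule at_within_nhd[of x "{..<y}"]) (use y J0 \<open>y \<in> J\<close> in auto)
        ultimately show "continuous (at x within J) u" by (simp add: continuous_within)
      qed
    qed
    moreover have "strong_bochner_integrable (lebesgue_on {0..t}) (\<lambda>s. blinfun_apply (P (t - s)) (N (u s))) \<and>
      u t = blinfun_apply (S t) u0 + strong_bochner_integral (lebesgue_on {0..t}) (\<lambda>s. blinfun_apply (P (t - s)) (N (u s)))"
      if t: "t \<in> J" for t
    proof -
      have "continuous_on {0..t} (\<lambda>s. N (u s))"
        using sol[OF t] by (intro continuous_on_N_compose) (simp add: sol_def)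
      from conv_integrable[OF J0(1)[OF t] this] sol[OF t] J0(1)[OF t] show ?thesis
        by (simp add: sol_def)
    qed
    ultimately show "mild_solution S P N u0 J u"
      using J unfolding mild_solution_def by blast
  qed
qed (simp add: mild_solution_def)

lemma sol_extend:
  assumes "0 \<le> T" "sol u0 T u"
  shows "\<exists>T'>T. \<exists>v. sol u0 T' v"
proof -
  have "continuous_on {0..T} u" using assms(2) by (simp add: sol_def)
  then obtain R where R: "\<And>t. t \<in> {0..T} \<Longrightarrow> norm (u t) \<le> R"
    using continuous_on_Icc_norm_bound by blast
  obtain d where d: "d > 0"
    "\<And>t0 u. 0 \<le> t0 \<Longrightarrow> t0 \<le> T \<Longrightarrow> sol u0 t0 u \<Longrightarrow> (\<And>t. t \<in> {0..t0} \<Longrightarrow> norm (u t) \<le> R) \<Longrightarrow> \<exists>v. sol u0 (t0 + d) v"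
    using sol_extend_uniform[OF assms(1), of u0 R] by blast
  from d(2)[OF assms(1) order_refl assms(2) R] d(1) show ?thesis
    by (intro exI[of _ "T + d"]) auto
qed

section \<open>The maximal solution\<close>

definition Tmax :: "'a \<Rightarrow> ereal" where
  "Tmax u0 = Sup (ereal ` {T. 0 \<le> T \<and> (\<exists>v. sol u0 T v)})"

text \<open>The chosen solution varies with t; uniqueness makes the values fit together, see
  \<open>max_sol_eq\<close>.\<close>

definition max_sol :: "'a \<Rightarrow> real \<Rightarrow> 'a" where
  "max_sol u0 t = (SOME v. sol u0 t v) t"

text \<open>Every solution on a compact interval extends strictly, so the supremum is never attained
  and the existence times fill exactly a half-open interval.\<close>

lemma mem_half_open_Tmax_iff: "t \<in> half_open_interval (Tmax u0) \<longleftrightarrow> 0 \<le> t \<and> (\<exists>v. sol u0 t v)"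
proof
  assume "t \<in> half_open_interval (Tmax u0)"
  then have t: "0 \<le> t" "ereal t < Tmax u0" by (auto simp: half_open_interval_def)
  then obtain T v where "t < T" "sol u0 T v"
    unfolding Tmax_def less_Sup_iff by auto
  with t show "0 \<le> t \<and> (\<exists>v. sol u0 t v)"
    using sol_mono less_imp_le by blast
next
  assume t: "0 \<le> t \<and> (\<exists>v. sol u0 t v)"
  then obtain T v where T: "t < T" "sol u0 T v" using sol_extend by blast
  then have "ereal T \<le> Tmax u0"
    unfolding Tmax_def using t by (intro Sup_upper) auto
  with T(1) have "ereal t < Tmax u0" by (simp add: less_le_trans[of _ "ereal T"])
  with t show "t \<in> half_open_interval (Tmax u0)" by (simp add: half_open_interval_def)
qed

lemma Tmax_pos: "0 < Tmax u0"
  using mem_half_open_Tmax_iff[of 0 u0] sol_0 by (auto simp: half_open_interval_def zero_ereal_def)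

lemma max_sol_eq:
  assumes "sol u0 T v" "0 \<le> t" "t \<le> T"
  shows "max_sol u0 t = v t"
proof -
  have v: "sol u0 t v" using sol_mono assms by blast
  then have "sol u0 t (SOME v. sol u0 t v)" by (rule someI[of "sol u0 t"])
  from sol_unique[OF this v] show ?thesis using assms by (simp add: max_sol_def)
qed

lemma sol_max_sol:
  assumes "t \<in> half_open_interval (Tmax u0)"
  shows "sol u0 t (max_sol u0)"
proof -
  obtain v where v: "sol u0 t v" using assms unfolding mem_half_open_Tmax_iff by blast
  then show ?thesis by (rule sol_cong) (rule max_sol_eq[OF v])
qed

text \<open>Every mild solution is thus a restriction of \<open>max_sol\<close>, from which both
  maximality and uniqueness of the maximal solution follow.\<close>

lemma mild_solution_eq_max_sol:
  assumes "mild_solution S P N u0 J v"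
  shows "J \<subseteq> half_open_interval (Tmax u0)" "\<And>t. t \<in> J \<Longrightarrow> v t = max_sol u0 t"
proof -
  have nonneg: "0 \<le> t" if "t \<in> J" for t
    using assms that unfolding mild_solution_def time_interval_def half_open_interval_def by auto
  have sol: "sol u0 t v" if "t \<in> J" for t
    using assms that unfolding mild_solution_iff by blast
  show "J \<subseteq> half_open_interval (Tmax u0)"
    using nonneg sol unfolding mem_half_open_Tmax_iff subset_iff by blast
  show "v t = max_sol u0 t" if "t \<in> J" for t
    using max_sol_eq[OF sol[OF that], of t] nonneg[OF that] by simp
qed

lemma mild_solution_max_sol: "mild_solution S P N u0 (half_open_interval (Tmax u0)) (max_sol u0)"
  unfolding mild_solution_iff time_interval_def using Tmax_pos sol_max_sol by blast

lemma maximal_mild_solution_max_sol: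
  "maximal_mild_solution S P N u0 (half_open_interval (Tmax u0)) (max_sol u0)"
  unfolding maximal_mild_solution_def
  using mild_solution_max_sol mild_solution_eq_max_sol(1) by blast

lemma maximal_mild_solution_unique:
  assumes "maximal_mild_solution S P N u0 J v"
  shows "J = half_open_interval (Tmax u0)" "\<forall>t\<in>J. v t = max_sol u0 t"
proof -
  have v: "mild_solution S P N u0 J v"
    and max: "\<And>J' w. J \<subset> J' \<Longrightarrow> mild_solution S P N u0 J' w \<Longrightarrow> \<exists>t\<in>J. w t \<noteq> v t"
    using assms unfolding maximal_mild_solution_def by auto
  note * = mild_solution_eq_max_sol[OF v]
  show "\<forall>t\<in>J. v t = max_sol u0 t" using *(2) by blast
  then show "J = half_open_interval (Tmax u0)"
    using max[OF _ mild_solution_max_sol] *(1) by (metis psubsetI)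
qed

text \<open>If the limsup is finite, the solution is bounded near T, and by compactness on the rest
  of [0,T). The uniform extension length \<open>d\<close> then carries a restriction ending close to
  T beyond T.\<close>

lemma blow_up:
  assumes "Tmax u0 < \<infinity>"
  shows "Limsup (at_left (real_of_ereal (Tmax u0))) (\<lambda>t. ereal (norm (max_sol u0 t))) = \<infinity>"
proof (rule ccontr)
  define T where "T = real_of_ereal (Tmax u0)"
  have Tmax: "Tmax u0 = ereal T" and "0 < T"
    using assms Tmax_pos[of u0] unfolding T_def by (cases "Tmax u0"; simp)+
  have dom: "t \<in> half_open_interval (Tmax u0) \<longleftrightarrow> 0 \<le> t \<and> t < T" for t
    by (simp add: half_open_interval_def Tmax)
  assume "Limsup (at_left (real_of_ereal (Tmax u0))) (\<lambda>t. ereal (norm (max_sol u0 t))) \<noteq> \<infinity>"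
  then have "Limsup (at_left T) (\<lambda>t. ereal (norm (max_sol u0 t))) < \<infinity>"
    by (simp add: T_def)
  then obtain K where "Limsup (at_left T) (\<lambda>t. ereal (norm (max_sol u0 t))) < ereal K"
    using ereal_dense2 by blast
  then have "\<forall>\<^sub>F t in at_left T. ereal (norm (max_sol u0 t)) < ereal K"
    by (rule Limsup_lessD)
  then have "\<forall>\<^sub>F t in at_left T. norm (max_sol u0 t) < K" by simp
  then obtain b where b: "b < T" "\<And>t. b < t \<Longrightarrow> t < T \<Longrightarrow> norm (max_sol u0 t) < K"
    unfolding eventually_at_left[OF \<open>0 < T\<close>] by blast
  \<comment> \<open>The time \<open>b\<close> may be negative; cutting at 0 gives a compact interval
    [0,c] for the remaining bound.\<close>
  define c where "c = max 0 b"
  have c: "0 \<le> c" "c < T" using b(1) \<open>0 < T\<close> by (auto simp: c_def)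
  have "continuous_on {0..c} (max_sol u0)"
    using sol_max_sol[of c u0] c by (simp add: dom sol_def)
  then obtain C where C: "\<And>t. t \<in> {0..c} \<Longrightarrow> norm (max_sol u0 t) \<le> C"
    using continuous_on_Icc_norm_bound by blast
  have R: "norm (max_sol u0 t) \<le> max C K" if "0 \<le> t" "t < T" for t
    using C[of t] b(2)[of t] that by (cases "t \<le> c") (auto simp: c_def le_max_iff_disj)
  obtain d where d: "d > 0"
    "\<And>t0 u. 0 \<le> t0 \<Longrightarrow> t0 \<le> T \<Longrightarrow> sol u0 t0 u \<Longrightarrow> (\<And>t. t \<in> {0..t0} \<Longrightarrow> norm (u t) \<le> max C K) \<Longrightarrow> \<exists>v. sol u0 (t0 + d) v"
    using sol_extend_uniform[of T u0 "max C K"] \<open>0 < T\<close> by auto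
  \<comment> \<open>Starting at most d/2 before T makes t0 + d exceed T; the maximum with 0 covers T
    below d/2.\<close>
  define t0 where "t0 = max 0 (T - d / 2)"
  have t0: "0 \<le> t0" "t0 < T" "T < t0 + d" using \<open>0 < T\<close> d(1) by (auto simp: t0_def)
  then have "\<exists>v. sol u0 (t0 + d) v"
    using sol_max_sol[of t0 u0] R by (intro d(2)) (auto simp: dom)
  then have "t0 + d \<in> half_open_interval (Tmax u0)"
    using t0 d(1) by (simp add: mem_half_open_Tmax_iff)
  with t0 show False by (simp add: dom)
qed

end

theorem theorem3p4:
  fixes S P :: "real \<Rightarrow> 'a::banach \<Rightarrow>\<^sub>L 'a"
    and N :: "'a \<Rightarrow> 'a"
  assumes S_strongly_continuous: "\<And>x. continuous_on {0..} (\<lambda>t. blinfun_apply (S t) x)"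
    and S_locally_bounded: "\<And>T. T > 0 \<Longrightarrow> bounded (S ` {0..T})"
    and S_0: "S 0 = id_blinfun"
    and P_L1: "\<And>T. T > 0 \<Longrightarrow> bochner_L1 (lebesgue_on {0<..<T}) P"
    and N_lipschitz: "lipschitz_on_bounded_sets N"
  shows "\<forall>u0. \<exists>(Tmax::ereal) u.
    0 < Tmax \<and>
    maximal_mild_solution S P N u0 (half_open_interval Tmax) u \<and>
    (\<forall>J v. maximal_mild_solution S P N u0 J v \<longrightarrow>
      J = half_open_interval Tmax \<and> (\<forall>t\<in>J. v t = u t)) \<and>
    (Tmax < \<infinity> \<longrightarrow>
      Limsup (at_left (real_of_ereal Tmax)) (\<lambda>t. ereal (norm (u t))) = \<infinity>)"
proof
  interpret mild_problem S P N
    using S_strongly_continuous P_L1 N_lipschitz by unfold_locales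
  fix u0
  show "\<exists>(Tmax::ereal) u. 0 < Tmax \<and>
    maximal_mild_solution S P N u0 (half_open_interval Tmax) u \<and>
    (\<forall>J v. maximal_mild_solution S P N u0 J v \<longrightarrow>
      J = half_open_interval Tmax \<and> (\<forall>t\<in>J. v t = u t)) \<and>
    (Tmax < \<infinity> \<longrightarrow>
      Limsup (at_left (real_of_ereal Tmax)) (\<lambda>t. ereal (norm (u t))) = \<infinity>)"
    using Tmax_pos maximal_mild_solution_max_sol maximal_mild_solution_unique blow_up
    by (intro exI[of _ "Tmax u0"] exI[of _ "max_sol u0"]) blast
qed

end
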